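(* Let $n$ be a perfect square and let $G$ be a $\sqrt{n}\times\sqrt{n}$ integer grid of $n$ points. Then the largest size of a monotone general position subset of $G$ is at least $\Omega\!\left((n/\log n)^{2/5}\right)$ and at most $o(n^{1/2})$.
   Context: A point set $P\subseteq\mathbb{R}^2$ is monotone if either (i) for all $u,v\in P$, $u_x<v_x$ implies $u_y\le v_y$, or (ii) for all $u,v\in P$, $u_x<v_x$ implies $u_y\ge v_y$. A set is in general position if it contains no three collinear points. Asymptotic notation refers to $n\to\infty$. *)

theory Defs
  imports
    "HOL-Analysis.Analysis"
    "HOL-Library.Landau_Symbols"
    "HOL-Computational_Algebra.Nth_Powers"
begin

definition monotone_points :: "(real \<times> real) set \<Rightarrow> bool" where
  "monotone_points P \<longleftrightarrow>
     (\<forall>u\<in>P. \<forall>v\<in>P. fst u < fst v \<longrightarrow> snd u \<le> snd v) \<or>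
     (\<forall>u\<in>P. \<forall>v\<in>P. fst u < fst v \<longrightarrow> snd u \<ge> snd v)"

definition general_position :: "(real \<times> real) set \<Rightarrow> bool" where
  "general_position P \<longleftrightarrow>
     (\<forall>u\<in>P. \<forall>v\<in>P. \<forall>w\<in>P. u \<noteq> v \<and> u \<noteq> w \<and> v \<noteq> w \<longrightarrow> \<not> collinear {u, v, w})"

definition square_integer_grid :: "nat \<Rightarrow> (real \<times> real) set \<Rightarrow> bool" where
  "square_integer_grid k G \<longleftrightarrow>
     (\<exists>a b :: int. G = real_of_int ` {a..<a + int k} \<times> real_of_int ` {b..<b + int k})"

(* Only meaningful for finite G; then the set under Max is finite and contains 0. *)
definition max_monotone_gp :: "(real \<times> real) set \<Rightarrow> nat" where
  "max_monotone_gp G = Max {card P | P. P \<subseteq> G \<and> monotone_points P \<and> general_position P}"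

definition at_top_squares :: "nat filter" where
  "at_top_squares = inf at_top (principal {n. is_square n})"

end

theory Submission
  imports Defs "HOL-Real_Asymp.Real_Asymp"
begin

text \<open>
  Upper bound. In the coordinates \<open>x \<plusminus> y\<close> and \<open>x \<mp> y\<close> a monotone set lies on the graph of a
  1-Lipschitz function \<open>f\<close>. Let \<open>\<rho>\<close> be the asymptotically best constant in the bound
  \<open>|U| \<le> \<rho> L (2 - \<sigma>\<^sup>2)\<close> for sets \<open>U\<close> without three collinear points over an interval of length \<open>L\<close> whose
  chord has slope \<open>\<sigma>\<close>. If \<open>\<rho> > 0\<close>, cut a nearly extremal \<open>U\<close> at an arbitrary point and apply the bound
  to both parts: as \<open>2 - \<sigma>\<^sup>2\<close> is strictly concave, the graph stays within \<open>\<delta> L\<close> of its chord. Then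
  the lattice lines in a direction of bounded size supplied by Dirichlet's theorem cover \<open>U\<close>, and
  they are fewer than \<open>|U| / 2\<close>.

  Lower bound. Place \<open>k\<close> cells of side \<open>s\<close> along the parabola \<open>y = x + x\<^sup>2 / X\<close>, where \<open>X = k s\<close>.
  Convexity forces collinear points with abscissa gaps \<open>d, d'\<close> near the parabola to satisfy
  \<open>d d' = O(s X)\<close>, so there are only \<open>O(s\<^sup>4 k\<^bsup>3/2\<^esup> log X)\<close> collinear triples in distinct cells.
  Picking a random point in each cell leaves at most \<open>k / 2\<close> of them on average when
  \<open>s\<^sup>2\<close> is of order \<open>k\<^bsup>1/2\<^esup> log X\<close>; delete one point from each.
\<close>

section \<open>Subsets of Lipschitz graphs without three collinear points\<close>

definition lipschitz_int :: "(int \<Rightarrow> int) \<Rightarrow> bool" where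
  "lipschitz_int f \<longleftrightarrow> (\<forall>u v. \<bar>f u - f v\<bar> \<le> \<bar>u - v\<bar>)"

definition graph_general_position :: "(int \<Rightarrow> int) \<Rightarrow> int set \<Rightarrow> bool" where
  "graph_general_position f U \<longleftrightarrow>
     (\<forall>u\<in>U. \<forall>v\<in>U. \<forall>w\<in>U. u \<noteq> v \<and> u \<noteq> w \<and> v \<noteq> w \<longrightarrow>
        (f v - f u) * (w - u) \<noteq> (f w - f u) * (v - u))"

lemma graph_general_position_subset:
  "graph_general_position f U \<Longrightarrow> V \<subseteq> U \<Longrightarrow> graph_general_position f V"
  unfolding graph_general_position_def by blast

lemma three_in_fibre:
  assumes "finite A" and "card A > 2 * card (g ` A)"
  obtains x y z where "x \<in> A" "y \<in> A" "z \<in> A" "x \<noteq> y" "x \<noteq> z" "y \<noteq> z" "g x = g y" "g x = g z"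
proof -
  have "\<exists>b\<in>g ` A. card {x\<in>A. g x = b} \<ge> 3"
  proof (rule ccontr)
    assume "\<not> ?thesis"
    then have le: "card {x\<in>A. g x = b} \<le> 2" if "b \<in> g ` A" for b
      using that by force
    have "card A = (\<Sum>b\<in>g ` A. card {x\<in>A. g x = b})"
      using sum.group[of A "g ` A" g "\<lambda>_. 1::nat"] assms(1) by simp
    also have "\<dots> \<le> (\<Sum>b\<in>g ` A. 2)" by (rule sum_mono) (rule le)
    finally show False using assms(2) by simp
  qed
  then obtain b where "card {x\<in>A. g x = b} \<ge> 3" by blast
  then obtain T where "T \<subseteq> {x\<in>A. g x = b}" "card T = 3"
    by (meson obtain_subset_with_card_n)
  then show ?thesis
    using that unfolding card_3_iff by auto
qed

lemma card_int_set_le: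
  fixes S :: "int set" and c R :: real
  assumes "\<And>z. z \<in> S \<Longrightarrow> \<bar>of_int z - c\<bar> \<le> R" and "R \<ge> 0"
  shows "finite S" and "real (card S) \<le> 2 * R + 1"
proof -
  have sub: "S \<subseteq> {\<lceil>c - R\<rceil>..\<lfloor>c + R\<rfloor>}"
  proof
    fix z assume "z \<in> S"
    then have "c - R \<le> of_int z" "of_int z \<le> c + R" using assms(1)[of z] by auto
    then show "z \<in> {\<lceil>c - R\<rceil>..\<lfloor>c + R\<rfloor>}" by (simp add: ceiling_le_iff le_floor_iff)
  qed
  then show "finite S" by (rule finite_subset) simp
  have "card S \<le> nat (\<lfloor>c + R\<rfloor> - \<lceil>c - R\<rceil> + 1)"
    using card_mono[OF _ sub] by simp
  then have "real (card S) \<le> real (nat (\<lfloor>c + R\<rfloor> - \<lceil>c - R\<rceil> + 1))" by simp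
  also have "\<dots> \<le> 2 * R + 1"
  proof (cases "\<lfloor>c + R\<rfloor> - \<lceil>c - R\<rceil> + 1 \<ge> 0")
    case True
    then have "real (nat (\<lfloor>c + R\<rfloor> - \<lceil>c - R\<rceil> + 1)) = of_int \<lfloor>c + R\<rfloor> - of_int \<lceil>c - R\<rceil> + 1" by simp
    then show ?thesis using of_int_floor_le[of "c+R"] le_of_int_ceiling[of "c-R"] by linarith
  next
    case False then show ?thesis using assms(2) by simp
  qed
  finally show "real (card S) \<le> 2 * R + 1" .
qed

text \<open>By Dirichlet's theorem, few lattice lines of a direction with small coordinates close to
  \<open>(1, s)\<close> cover a flat piece of the graph.\<close>

lemma flat_graph_collinear:
  fixes s \<delta> :: real and Q L :: nat
  assumes "U \<subseteq> {t..<t + int L}"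
    and flat: "\<And>w. w \<in> U \<Longrightarrow> \<bar>of_int (f w) - of_int (f t) - s * of_int (w - t)\<bar> \<le> \<delta> * L"
    and "Q > 0" "\<delta> \<ge> 0"
    and many: "real (card U) > 4 * Q * \<delta> * L + 4 * L / Q + 2"
  shows "\<not> graph_general_position f U"
proof -
  obtain h q where q: "0 < q" "q \<le> int Q" and qs: "\<bar>of_int q * s - of_int h\<bar> < 1 / Q"
    using Dirichlet_approx[OF \<open>Q > 0\<close>] by metis
  \<comment> \<open>A level set of \<open>g\<close> consists of the graph points on one lattice line
    of direction \<open>(q, h)\<close>, so three points of \<open>U\<close> with equal
    \<open>g\<close> are collinear. \<open>R\<close> bounds the distance from values of
    \<open>g\<close> on \<open>U\<close> to its value at \<open>t\<close>, leaving at most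
    \<open>2 * R + 1\<close> lines.\<close>
  define g where "g w = q * f w - h * w" for w
  define R where "R = Q * \<delta> * L + L / Q"
  have "R \<ge> 0" unfolding R_def using assms by simp
  have dist: "\<bar>of_int z - of_int (q * f t - h * t)\<bar> \<le> R" if z: "z \<in> g ` U" for z
  proof -
    from z obtain w where w: "w \<in> U" "z = g w" by blast
    let ?e = "of_int (f w) - of_int (f t) - s * of_int (w - t) :: real"
    have "of_int z - of_int (q * f t - h * t) = of_int q * ?e + (of_int q * s - of_int h) * of_int (w - t)"
      unfolding w g_def by (simp add: algebra_simps)
    also have "\<bar>\<dots>\<bar> \<le> \<bar>of_int q\<bar> * \<bar>?e\<bar> + \<bar>of_int q * s - of_int h\<bar> * \<bar>of_int (w - t)\<bar>"
      using abs_triangle_ineq by (metis abs_mult)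
    also have "\<dots> \<le> Q * (\<delta> * L) + (1 / Q) * L"
    proof (intro add_mono mult_mono)
      show "\<bar>of_int q\<bar> \<le> real Q" using q by linarith
      show "\<bar>of_int (w - t)\<bar> \<le> real L" using w assms(1) by force
    qed (use flat[OF w(1)] qs in auto)
    finally show ?thesis by (simp add: R_def mult.assoc)
  qed
  have "finite U" using assms(1) finite_subset by blast
  have "real (card (g ` U)) \<le> 2 * R + 1" using card_int_set_le(2)[OF dist \<open>R \<ge> 0\<close>] .
  then have "real (card U) > real (2 * card (g ` U))" using many
    unfolding R_def by (simp add: distrib_left mult.assoc)
  then have "card U > 2 * card (g ` U)" by linarith
  then obtain x y z where xyz: "x \<in> U" "y \<in> U" "z \<in> U" "x \<noteq> y" "x \<noteq> z" "y \<noteq> z" "g x = g y" "g x = g z"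
    using three_in_fibre \<open>finite U\<close> by metis
  have 1: "q * (f y - f x) = h * (y - x)" and 2: "q * (f z - f x) = h * (z - x)"
    using xyz(7,8) unfolding g_def by (simp_all add: algebra_simps)
  have "q * ((f y - f x) * (z - x)) = q * ((f z - f x) * (y - x))"
    unfolding mult.assoc[symmetric] 1 2 by (simp add: algebra_simps)
  then have "(f y - f x) * (z - x) = (f z - f x) * (y - x)" using q by simp
  then show ?thesis using xyz unfolding graph_general_position_def by blast
qed

section \<open>Density bounds relative to a strictly concave weight\<close>

definition chord_weight :: "(int \<Rightarrow> int) \<Rightarrow> int \<Rightarrow> nat \<Rightarrow> real" where
  "chord_weight f t L = L * (2 - (of_int (f (t + int L) - f t) / L)\<^sup>2)"

text \<open>A Lipschitz chord has slope at most 1 in absolute value, so the factor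
  \<open>2 - slope^2\<close> stays in [1, 2]. The constant 2 in \<open>chord_weight\<close> thus
  makes the weight comparable to the length.\<close>

lemma chord_weight_bounds:
  assumes "lipschitz_int f"
  shows "real L \<le> chord_weight f t L" and "chord_weight f t L \<le> 2 * real L"
proof -
  have "\<bar>f (t + int L) - f t\<bar> \<le> int L" using assms unfolding lipschitz_int_def
    by (metis abs_of_nat add_diff_cancel_left')
  then have "real_of_int \<bar>f (t + int L) - f t\<bar> \<le> real L" by linarith
  then have "\<bar>of_int (f (t + int L) - f t) / real L\<bar> \<le> 1" by (simp add: divide_simps)
  then have "(of_int (f (t + int L) - f t) / real L)\<^sup>2 \<le> 1" by (simp add: abs_square_le_1)
  then have "real L * 1 \<le> chord_weight f t L" "chord_weight f t L \<le> real L * 2"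
    unfolding chord_weight_def by (intro mult_left_mono; simp)+
  then show "real L \<le> chord_weight f t L" "chord_weight f t L \<le> 2 * real L" by simp_all
qed

text \<open>The threshold \<open>M\<close> is uniform in \<open>f\<close>, \<open>t\<close> and
  \<open>U\<close>, so one bound serves a long graph and both parts of any cut that are long
  enough.\<close>

definition density_bound :: "real \<Rightarrow> bool" where
  "density_bound c \<longleftrightarrow> (\<exists>M::nat. \<forall>L\<ge>M. \<forall>f t U. lipschitz_int f \<longrightarrow> U \<subseteq> {t..<t + int L} \<longrightarrow>
      graph_general_position f U \<longrightarrow> real (card U) \<le> c * chord_weight f t L)"

lemma density_bound_mono: "density_bound c \<Longrightarrow> c \<le> d \<Longrightarrow> density_bound d"
  unfolding density_bound_def
  by (meson chord_weight_bounds(1) mult_right_mono of_nat_0_le_iff order_trans)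

lemma density_bound_1: "density_bound 1"
proof -
  have "real (card U) \<le> 1 * chord_weight f t L"
    if "lipschitz_int f" "U \<subseteq> {t..<t + int L}" for L f t U
    using card_mono[OF _ that(2)] chord_weight_bounds(1)[OF that(1), of L t] by simp
  then show ?thesis unfolding density_bound_def by blast
qed

text \<open>Strict concavity of the weight: if cutting at \<open>t + L1\<close> does not lower the total weight much,
  the graph passes close to the chord there.\<close>

lemma chord_deviation_sq:
  fixes L1 L2 :: nat
  assumes "L1 > 0" "L2 > 0"
  defines "L \<equiv> L1 + L2"
  shows "(of_int (f (t + int L1)) - of_int (f t) - of_int (f (t + int L) - f t) / L * L1)\<^sup>2
          \<le> L * (chord_weight f t L - chord_weight f t L1 - chord_weight f (t + int L1) L2)"
proof -
  define A where "A = (of_int (f (t + int L1) - f t) :: real)"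
  define B where "B = (of_int (f (t + int L) - f (t + int L1)) :: real)"
  have AB: "of_int (f (t + int L) - f t) = A + B" unfolding A_def B_def by simp
  have pos: "real L1 > 0" "real L2 > 0" "real L = real L1 + real L2" "real L > 0"
    using assms by auto
  have w: "chord_weight f t L - chord_weight f t L1 - chord_weight f (t + int L1) L2
      = A\<^sup>2 / L1 + B\<^sup>2 / L2 - (A + B)\<^sup>2 / L"
    unfolding chord_weight_def AB
    using pos A_def B_def L_def
    by (simp add: add.assoc divide_simps power2_eq_square) (simp add: algebra_simps)
  have dev: "A - (A + B) / L * L1 = (A * L2 - B * L1) / L"
    using pos by (simp add: divide_simps) (simp add: algebra_simps)
  \<comment> \<open>The deficit is an exact square of the cross product
    \<open>A * L2 - B * L1\<close>, which is also the numerator of the deviation in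
    \<open>dev\<close>.\<close>
  have "A\<^sup>2 / L1 + B\<^sup>2 / L2 - (A + B)\<^sup>2 / L = (A * L2 - B * L1)\<^sup>2 / (L * L1 * L2)"
    using pos by (simp add: divide_simps) (simp add: algebra_simps power2_eq_square)
  then have "L * (A\<^sup>2 / L1 + B\<^sup>2 / L2 - (A + B)\<^sup>2 / L) = (A * L2 - B * L1)\<^sup>2 / (real L1 * L2)"
    using pos by simp
  moreover have "(A * L2 - B * L1)\<^sup>2 / (real L)\<^sup>2 \<le> (A * L2 - B * L1)\<^sup>2 / (real L1 * L2)"
  proof (rule divide_left_mono)
    show "real L1 * L2 \<le> (real L)\<^sup>2" using pos by (simp add: power2_eq_square algebra_simps)
  qed (use pos in auto)
  ultimately show ?thesis unfolding w AB using dev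
    by (simp add: A_def power_divide)
qed

text \<open>Some long \<open>U\<close> violates the bound with \<open>\<rho> - \<eta>\<close>, while
  both parts of a cut obey it with \<open>\<rho> + \<eta>\<close>. This leaves room for only a small
  weight deficit \<open>D\<close> at each cut, which makes \<open>U\<close> too flat to avoid
  collinear triples.\<close>

lemma no_positive_optimal_density:
  assumes "\<rho> > 0" and above: "\<And>c. c > \<rho> \<Longrightarrow> density_bound c"
  shows "\<exists>c<\<rho>. density_bound c"
proof (rule ccontr)
  assume none: "\<not> ?thesis"
  \<comment> \<open>\<open>Q\<close> and \<open>\<delta>\<close> make the terms
    \<open>4 * L / Q\<close> and \<open>4 * Q * \<delta> * L\<close> of
    \<open>flat_graph_collinear\<close> at most \<open>\<rho> / 8 * L\<close> each. The two bounds
    on \<open>\<eta>\<close> yield \<open>card U > \<rho> / 2 * L\<close> and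
    \<open>D \<le> \<delta>\<^sup>2 * L\<close> respectively.\<close>
  define Q where "Q = nat \<lceil>32 / \<rho>\<rceil>"
  have Q: "Q > 0" "real Q \<ge> 32 / \<rho>" unfolding Q_def using \<open>\<rho> > 0\<close> by (simp, linarith)
  define \<delta> where "\<delta> = \<rho> / (32 * Q)"
  have "\<delta> > 0" unfolding \<delta>_def using Q \<open>\<rho> > 0\<close> by simp
  define \<eta> where "\<eta> = min (\<rho> / 2) (\<delta>\<^sup>2 * \<rho> / 4)"
  have \<eta>: "\<eta> > 0" "\<eta> \<le> \<rho> / 2" "4 * \<eta> \<le> \<delta>\<^sup>2 * \<rho>" unfolding \<eta>_def using \<open>\<rho> > 0\<close> \<open>\<delta> > 0\<close> by auto
  have "density_bound (\<rho> + \<eta>)" using above \<eta>(1) by simp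
  then obtain M where M: "\<And>L f t U. \<lbrakk>L \<ge> M; lipschitz_int f; U \<subseteq> {t..<t + int L};
      graph_general_position f U\<rbrakk> \<Longrightarrow> real (card U) \<le> (\<rho> + \<eta>) * chord_weight f t L"
    unfolding density_bound_def by blast
  \<comment> \<open>The first entry makes the remaining summand 2 at most
    \<open>\<rho> / 8 * L\<close>; the second makes \<open>2 * M\<close> smaller than
    \<open>\<delta> * L\<close>, which handles cuts close to an endpoint.\<close>
  define L0 where "L0 = nat \<lceil>max (16 / \<rho> + 1) (2 * (real M + 1) / \<delta>)\<rceil>"
  have "\<not> density_bound (\<rho> - \<eta>)" using none \<eta>(1) by simp
  then obtain L f t U where LU: "L \<ge> L0" "lipschitz_int f" "U \<subseteq> {t..<t + int L}"
      "graph_general_position f U" and big: "real (card U) > (\<rho> - \<eta>) * chord_weight f t L"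
    unfolding density_bound_def not_all not_ex not_imp not_le by blast
  have L0: "real L0 \<ge> 16 / \<rho> + 1" "real L0 \<ge> 2 * (real M + 1) / \<delta>"
    unfolding L0_def by linarith+
  have L: "real L \<ge> 16 / \<rho> + 1" "real L \<ge> 2 * (real M + 1) / \<delta>"
    using L0 LU(1) by linarith+
  have Lpos: "real L > 0" using L(1) \<open>\<rho> > 0\<close> by (smt (verit) divide_pos_pos)
  have MdL: "2 * (real M + 1) \<le> \<delta> * L" using L(2) \<open>\<delta> > 0\<close> by (simp add: field_simps)
  define s where "s = of_int (f (t + int L) - f t) / real L"
  have lip: "\<bar>of_int (f u) - of_int (f v)\<bar> \<le> \<bar>of_int u - of_int v :: real\<bar>" for u v
    using LU(2) unfolding lipschitz_int_def by (metis of_int_abs of_int_diff of_int_le_iff)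
  have s1: "\<bar>s\<bar> \<le> 1" using lip[of "t + int L" t] Lpos unfolding s_def by (simp add: abs_le_iff field_simps)
  have flat: "\<bar>of_int (f w) - of_int (f t) - s * of_int (w - t)\<bar> \<le> \<delta> * L" if w: "w \<in> U" for w
  proof -
    define L1 where "L1 = nat (w - t)"
    define L2 where "L2 = L - L1"
    have "t \<le> w" "w < t + int L" using w LU(3) by auto
    then have wt: "w = t + int L1" "L1 < L" unfolding L1_def by auto
    have LL: "L = L1 + L2" "L2 > 0" using wt L2_def by auto
    \<comment> \<open>A part of length at most \<open>M\<close> is not covered by the density bound.
      There the Lipschitz condition and the slope bound \<open>s1\<close> give a deviation of at
      most \<open>2 * M\<close>, measured from the nearer end.\<close>
    consider "L1 \<le> M" | "L2 \<le> M" | "L1 > M" "L2 > M" by linarith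
    then show ?thesis
    proof cases
      case 1
      have "\<bar>s * real L1\<bar> \<le> 1 * real L1" unfolding abs_mult using s1 by (intro mult_mono) auto
      moreover have "real L1 \<le> real M" using 1 by simp
      ultimately show ?thesis using lip[of w t] MdL unfolding wt by simp
    next
      case 2
      have "s * real L = of_int (f (t + int L)) - of_int (f t)" using Lpos unfolding s_def by simp
      then have "of_int (f w) - of_int (f t) - s * of_int (w - t)
          = of_int (f w) - of_int (f (t + int L)) + s * real L2"
        unfolding wt LL by (simp add: algebra_simps)
      moreover have "\<bar>s * real L2\<bar> \<le> 1 * real L2" unfolding abs_mult using s1 by (intro mult_mono) auto
      moreover have "real L2 \<le> real M" using 2 by simp
      ultimately show ?thesis using lip[of w "t + int L"] MdL unfolding wt LL by simp
    next
      case 3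
      define U1 where "U1 = U \<inter> {t..<t + int L1}"
      define U2 where "U2 = U \<inter> {w..<w + int L2}"
      have "U \<subseteq> U1 \<union> U2" using LU(3) unfolding U1_def U2_def wt LL by auto
      moreover have fin: "finite U1" "finite U2" unfolding U1_def U2_def by auto
      ultimately have "card U \<le> card U1 + card U2"
        by (meson card_Un_le card_mono finite_UnI order_trans)
      moreover have "real (card U1) \<le> (\<rho> + \<eta>) * chord_weight f t L1"
        using M[of L1 f U1 t] 3 LU graph_general_position_subset unfolding U1_def by auto
      moreover have "real (card U2) \<le> (\<rho> + \<eta>) * chord_weight f w L2"
        using M[of L2 f U2 w] 3 LU graph_general_position_subset unfolding U2_def by auto
      ultimately have cU: "real (card U) \<le> (\<rho> + \<eta>) * (chord_weight f t L1 + chord_weight f w L2)"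
        by (simp add: algebra_simps)
      define D where "D = chord_weight f t L - chord_weight f t L1 - chord_weight f w L2"
      \<comment> \<open>Lower bound for the whole against upper bound for the two parts; rearranged,
        \<open>D\<close> is at most of the order of \<open>\<eta> * L / \<rho>\<close>.\<close>
      have "(\<rho> - \<eta>) * chord_weight f t L \<le> (\<rho> + \<eta>) * (chord_weight f t L - D)"
        using big cU unfolding D_def by simp
      then have "(\<rho> + \<eta>) * D \<le> 2 * \<eta> * chord_weight f t L" by (simp add: algebra_simps)
      also have "\<dots> \<le> 2 * \<eta> * (2 * L)"
        using chord_weight_bounds(2)[OF LU(2)] \<eta>(1) by (intro mult_left_mono) auto
      also have "\<dots> \<le> \<delta>\<^sup>2 * \<rho> * L" using \<eta>(3) Lpos by (simp add: mult_right_mono)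
      finally have b: "(\<rho> + \<eta>) * D \<le> \<delta>\<^sup>2 * \<rho> * L" .
      have "D \<le> \<delta>\<^sup>2 * L"
      proof (rule ccontr)
        assume "\<not> ?thesis"
        then have "D > \<delta>\<^sup>2 * L" by simp
        moreover have "\<delta>\<^sup>2 * real L \<ge> 0" by simp
        ultimately have "D > 0" "\<rho> * (\<delta>\<^sup>2 * L) < \<rho> * D" using \<open>\<rho> > 0\<close> by (linarith, simp)
        moreover from this have "\<eta> * D \<ge> 0" using \<eta>(1) by simp
        ultimately show False using b by (simp add: algebra_simps)
      qed
      then have "L * D \<le> (\<delta> * L)\<^sup>2" using Lpos by (simp add: power2_eq_square algebra_simps)
      moreover have "(of_int (f w) - of_int (f t) - s * of_int (w - t))\<^sup>2 \<le> L * D"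
        using chord_deviation_sq[of L1 L2 f t] 3 LL unfolding D_def s_def wt by simp
      ultimately have "(of_int (f w) - of_int (f t) - s * of_int (w - t))\<^sup>2 \<le> (\<delta> * L)\<^sup>2" by linarith
      then show ?thesis using \<open>\<delta> > 0\<close> Lpos by (metis abs_le_square_iff abs_of_pos mult_pos_pos)
    qed
  qed
  have "(\<rho> - \<eta>) * chord_weight f t L \<ge> \<rho> / 2 * L"
    using chord_weight_bounds(1)[OF LU(2), of L t] \<eta> \<open>\<rho> > 0\<close> by (intro mult_mono) auto
  moreover have "4 * Q * \<delta> * L = \<rho> / 8 * L" unfolding \<delta>_def using Q by simp
  moreover have "4 * L / Q \<le> \<rho> / 8 * L"
  proof -
    have "4 / Q \<le> \<rho> / 8" using Q \<open>\<rho> > 0\<close> by (simp add: field_simps)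
    then show ?thesis using Lpos mult_right_mono[of "4 / Q" "\<rho> / 8" "real L"] by simp
  qed
  moreover have "2 \<le> \<rho> / 8 * L"
  proof -
    have "16 / \<rho> \<le> L" using L(1) by simp
    then show ?thesis using \<open>\<rho> > 0\<close> by (simp add: field_simps)
  qed
  moreover have "\<rho> / 8 * L > 0" using Lpos \<open>\<rho> > 0\<close> by simp
  ultimately have "real (card U) > 4 * Q * \<delta> * L + 4 * L / Q + 2" using big by linarith
  then show False
    using flat_graph_collinear[OF LU(3) flat Q(1) less_imp_le[OF \<open>\<delta> > 0\<close>]] LU(4) by blast
qed

text \<open>The infimum of the admissible nonnegative constants cannot be positive: everything above
  it is admissible, so \<open>no_positive_optimal_density\<close> would produce an admissible
  constant below it.\<close>

lemma density_bound_pos: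
  assumes "\<epsilon> > 0" shows "density_bound \<epsilon>"
proof -
  define S where "S = {c. 0 \<le> c \<and> density_bound c}"
  have S: "S \<noteq> {}" "bdd_below S" unfolding S_def using density_bound_1 zero_le_one
    by (blast, auto intro: bdd_belowI[of _ 0])
  have above: "density_bound c" if "c > Inf S" for c
    using that S density_bound_mono unfolding S_def by (auto simp: cInf_less_iff)
  have "Inf S \<le> 0"
  proof (rule ccontr)
    assume "\<not> Inf S \<le> 0"
    then obtain c where "c < Inf S" "density_bound c" using no_positive_optimal_density above
      by (metis not_le)
    \<comment> \<open>The constant \<open>c\<close> might be negative, hence outside
      \<open>S\<close>; raising it to 0 keeps it admissible and still below a positive
      infimum.\<close>
    then have "max c 0 \<in> S" "max c 0 < Inf S" using density_bound_mono \<open>\<not> Inf S \<le> 0\<close>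
      unfolding S_def by auto
    then show False using cInf_lower[OF _ S(2)] by fastforce
  qed
  then show ?thesis using above assms by simp
qed

section \<open>From monotone grid subsets to Lipschitz graphs\<close>

lemma lipschitz_extension:
  fixes P :: "(int \<times> int) set"
  assumes "finite P" "P \<noteq> {}"
    and lip: "\<And>p q. p \<in> P \<Longrightarrow> q \<in> P \<Longrightarrow> \<bar>snd p - snd q\<bar> \<le> \<bar>fst p - fst q\<bar>"
  obtains f where "lipschitz_int f" "\<And>p. p \<in> P \<Longrightarrow> f (fst p) = snd p"
proof -
  \<comment> \<open>McShane extension: the lower envelope of the cones of slope 1 standing on the
    points of \<open>P\<close>. The condition on \<open>P\<close> ensures that no cone dips below
    another point.\<close>
  define f where "f u = Min ((\<lambda>p. snd p + \<bar>u - fst p\<bar>) ` P)" for u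
  have le: "f u \<le> snd p + \<bar>u - fst p\<bar>" if "p \<in> P" for u p
    unfolding f_def using assms(1) that by auto
  have att: "\<exists>p\<in>P. f u = snd p + \<bar>u - fst p\<bar>" for u
  proof -
    have "f u \<in> (\<lambda>p. snd p + \<bar>u - fst p\<bar>) ` P" unfolding f_def using assms by (intro Min_in) auto
    then show ?thesis by blast
  qed
  have "f u - f v \<le> \<bar>u - v\<bar>" for u v
  proof -
    obtain p where "p \<in> P" "f v = snd p + \<bar>v - fst p\<bar>" using att by blast
    then show ?thesis using le[of p u] by linarith
  qed
  then have "lipschitz_int f" unfolding lipschitz_int_def
    by (smt (verit) abs_minus_commute)
  moreover have "f (fst p) = snd p" if p: "p \<in> P" for p
  proof -
    obtain q where "q \<in> P" "f (fst p) = snd q + \<bar>fst p - fst q\<bar>" using att by blast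
    then show ?thesis using le[OF p, of "fst p"] lip[OF p] by fastforce
  qed
  ultimately show ?thesis using that by blast
qed

lemma collinear_iff_det:
  fixes u v w :: "real \<times> real"
  shows "collinear {u, v, w} \<longleftrightarrow>
    (fst v - fst u) * (snd w - snd u) = (fst w - fst u) * (snd v - snd u)"
proof -
  obtain a b where d: "v - u = (a, b)" by (metis surj_pair)
  obtain c e where d': "w - u = (c, e)" by (metis surj_pair)
  have eq: "fst v - fst u = a" "snd v - snd u = b" "fst w - fst u = c" "snd w - snd u = e"
    using d d' by (metis fst_diff fst_conv, metis snd_diff snd_conv, metis fst_diff fst_conv, metis snd_diff snd_conv)
  have "collinear {u, v, w} \<longleftrightarrow> collinear {0, v - u, w - u}"
    using collinear_3[of v u w] by (simp add: insert_commute)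
  also have "\<dots> \<longleftrightarrow> a * e = c * b"
  proof
    assume "collinear {0, v - u, w - u}"
    then show "a * e = c * b" unfolding d d' collinear_lemma by (auto simp: zero_prod_def)
  next
    assume det: "a * e = c * b"
    have "\<exists>r. (c, e) = r *\<^sub>R (a, b)" if "(a, b) \<noteq> 0"
    proof (cases "a = 0")
      case True
      then show ?thesis using det that by (intro exI[of _ "e / b"]) (auto simp: zero_prod_def)
    next
      case False
      then show ?thesis using det by (intro exI[of _ "c / a"]) (simp add: field_simps)
    qed
    then show "collinear {0, v - u, w - u}" unfolding d d' collinear_lemma by blast
  qed
  finally show ?thesis unfolding eq .
qed


text \<open>Turning by 45 degrees maps the grid onto an interval of length \<open>2 * k\<close>,
  whose chord weight is at most \<open>4 * k\<close>; hence the density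
  \<open>\<epsilon> / 4\<close>.\<close>

lemma monotone_gp_card_upper:
  fixes \<epsilon> :: real
  assumes "\<epsilon> > 0"
  obtains M :: nat where "\<And>k G P. \<lbrakk>k \<ge> M; square_integer_grid k G; P \<subseteq> G; monotone_points P;
    general_position P\<rbrakk> \<Longrightarrow> real (card P) \<le> \<epsilon> * k"
proof -
  have "density_bound (\<epsilon> / 4)" using assms by (intro density_bound_pos) simp
  then obtain M where M: "\<And>L f t U. \<lbrakk>L \<ge> M; lipschitz_int f; U \<subseteq> {t..<t + int L};
      graph_general_position f U\<rbrakk> \<Longrightarrow> real (card U) \<le> \<epsilon> / 4 * chord_weight f t L"
    unfolding density_bound_def by blast
  have "real (card P) \<le> \<epsilon> * k"
    if k: "k \<ge> M" and G: "square_integer_grid k G" and P: "P \<subseteq> G" and mon: "monotone_points P"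
      and gp: "general_position P" for k G P
  proof (cases "P = {}")
    case True then show ?thesis using assms by simp
  next
    case False
    obtain a b where Geq: "G = real_of_int ` {a..<a + int k} \<times> real_of_int ` {b..<b + int k}"
      using G unfolding square_integer_grid_def by blast
    define emb where "emb = (\<lambda>p :: int \<times> int. (real_of_int (fst p), real_of_int (snd p)))"
    define R where "R = {p. emb p \<in> P}"
    have Pim: "P = emb ` R"
    proof -
      have "p \<in> range emb" if pP: "p \<in> P" for p
      proof -
        obtain x y where "p = (real_of_int x, real_of_int y)" using pP P Geq by auto
        then have "p = emb (x, y)" unfolding emb_def by simp
        then show ?thesis by blast
      qed
      then show ?thesis unfolding R_def by blast
    qed
    have Rbox: "R \<subseteq> {a..<a + int k} \<times> {b..<b + int k}"
      using P unfolding R_def Geq emb_def by auto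
    have "finite R" using Rbox finite_subset by blast
    have "R \<noteq> {}" using False Pim by blast
    have "inj emb" unfolding emb_def by (auto intro: injI simp: prod_eq_iff)
    then have cardP: "card P = card R" unfolding Pim by (meson card_image inj_on_subset subset_UNIV)
    obtain \<sigma> :: int where \<sigma>: "\<sigma> = 1 \<or> \<sigma> = -1"
      and R_mono: "\<And>p q. p \<in> R \<Longrightarrow> q \<in> R \<Longrightarrow> fst p < fst q \<Longrightarrow> \<sigma> * snd p \<le> \<sigma> * snd q"
    proof -
      have im: "emb p \<in> P" if "p \<in> R" for p using that R_def by simp
      from mon consider "\<forall>u\<in>P. \<forall>v\<in>P. fst u < fst v \<longrightarrow> snd u \<le> snd v"
        | "\<forall>u\<in>P. \<forall>v\<in>P. fst u < fst v \<longrightarrow> snd u \<ge> snd v"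
        unfolding monotone_points_def by blast
      then show ?thesis
      proof cases
        case 1
        have "1 * snd p \<le> 1 * snd q" if "p \<in> R" "q \<in> R" "fst p < fst q" for p q
          using bspec[OF bspec[OF 1 im[OF that(1)]] im[OF that(2)]] that(3) unfolding emb_def by simp
        then show ?thesis using that[of 1] by blast
      next
        case 2
        have "-1 * snd p \<le> -1 * snd q" if "p \<in> R" "q \<in> R" "fst p < fst q" for p q
          using bspec[OF bspec[OF 2 im[OF that(1)]] im[OF that(2)]] that(3) unfolding emb_def by simp
        then show ?thesis using that[of "-1"] by blast
      qed
    qed
    \<comment> \<open>With the sign \<open>\<sigma>\<close> the set is nondecreasing, so the two
      coordinate differences never have opposite signs and their difference is at most their sum in
      absolute value. This is \<open>lipF\<close>.\<close>
    define F where "F p = (fst p + \<sigma> * snd p, fst p - \<sigma> * snd p)" for p :: "int \<times> int"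
    have lipF: "\<bar>snd (F p) - snd (F q)\<bar> \<le> \<bar>fst (F p) - fst (F q)\<bar>" if "p \<in> R" "q \<in> R" for p q
    proof -
      consider "fst p < fst q" | "fst q < fst p" | "fst p = fst q" by linarith
      then show ?thesis
      proof cases
        case 1 then show ?thesis using R_mono[OF that 1] unfolding F_def by simp
      next
        case 2 then show ?thesis using R_mono[OF that(2,1) 2] unfolding F_def by simp
      next
        case 3 then show ?thesis unfolding F_def by simp
      qed
    qed
    have "\<bar>snd p - snd q\<bar> \<le> \<bar>fst p - fst q\<bar>" if "p \<in> F ` R" "q \<in> F ` R" for p q
      using that lipF by blast
    then obtain f where f: "lipschitz_int f" and "\<And>p. p \<in> F ` R \<Longrightarrow> f (fst p) = snd p"
      using lipschitz_extension[of "F ` R"] \<open>finite R\<close> \<open>R \<noteq> {}\<close> by blast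
    then have fF: "f (fst (F p)) = snd (F p)" if "p \<in> R" for p using that by blast
    define U where "U = (\<lambda>p. fst (F p)) ` R"
    have "inj_on (\<lambda>p. fst (F p)) R"
    proof (rule inj_onI)
      fix p q assume pq: "p \<in> R" "q \<in> R" "fst (F p) = fst (F q)"
      then have "snd (F p) = snd (F q)" using fF by metis
      then show "p = q" using pq(3) \<sigma> unfolding F_def by (auto simp: prod_eq_iff)
    qed
    then have cardU: "card U = card P" unfolding U_def cardP by (rule card_image)
    define t where "t = (if \<sigma> = 1 then a + b else a - b - int k)"
    have Ut: "U \<subseteq> {t..<t + int (2 * k)}"
    proof
      fix u assume "u \<in> U"
      then obtain p where "p \<in> R" "u = fst p + \<sigma> * snd p" unfolding U_def F_def by auto
      moreover from this have "fst p \<in> {a..<a + int k}" "snd p \<in> {b..<b + int k}"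
        using Rbox by auto
      ultimately show "u \<in> {t..<t + int (2 * k)}" using \<sigma> unfolding t_def by auto
    qed
    have "graph_general_position f U"
      unfolding graph_general_position_def
    proof (intro ballI impI notI)
      fix u v w
      assume uvw: "u \<in> U" "v \<in> U" "w \<in> U" "u \<noteq> v \<and> u \<noteq> w \<and> v \<noteq> w"
        and eq: "(f v - f u) * (w - u) = (f w - f u) * (v - u)"
      obtain p q r where pqr: "p \<in> R" "q \<in> R" "r \<in> R" "u = fst (F p)" "v = fst (F q)" "w = fst (F r)"
        using uvw unfolding U_def by blast
      \<comment> \<open>The linear map \<open>F\<close> has determinant
        \<open>-2 * \<sigma>\<close>, which is nonzero, so vanishing cross products carry back to
        the original coordinates.\<close>
      have "2 * \<sigma> * ((fst q - fst p) * (snd r - snd p)) = 2 * \<sigma> * ((fst r - fst p) * (snd q - snd p))"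
        using eq unfolding pqr(4-6) fF[OF pqr(1)] fF[OF pqr(2)] fF[OF pqr(3)] unfolding F_def
        by (simp add: algebra_simps)
      then have "(fst q - fst p) * (snd r - snd p) = (fst r - fst p) * (snd q - snd p)"
        using \<sigma> by auto
      then have "real_of_int ((fst q - fst p) * (snd r - snd p)) = real_of_int ((fst r - fst p) * (snd q - snd p))"
        by (rule arg_cong)
      then have "collinear {emb p, emb q, emb r}" unfolding collinear_iff_det emb_def by simp
      moreover have "emb p \<noteq> emb q" "emb p \<noteq> emb r" "emb q \<noteq> emb r"
        using uvw(4) pqr \<open>inj emb\<close> by (auto dest: injD)
      ultimately show False using gp pqr(1-3) unfolding general_position_def R_def by blast
    qed
    then have "real (card U) \<le> \<epsilon> / 4 * chord_weight f t (2 * k)"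
      using M[OF _ f Ut] k by simp
    also have "\<dots> \<le> \<epsilon> / 4 * (2 * real (2 * k))"
      using assms chord_weight_bounds(2)[OF f, of t "2 * k"] by (intro mult_left_mono) auto
    finally show ?thesis using cardU by simp
  qed
  then show ?thesis using that by blast
qed

section \<open>Random transversals\<close>

text \<open>First moment with deletion, carried out by counting over all choice functions: each bad
  triple occurs in a fraction \<open>1 / S^3\<close> of them, so some choice meets at most
  \<open>k / 2\<close> bad triples.\<close>

lemma transversal_avoiding_triples:
  fixes C :: "nat \<Rightarrow> 'a set" and k S :: nat
  assumes cardC: "\<And>i. i < k \<Longrightarrow> card (C i) = S" and "S > 0"
    and few: "2 * card {(i, j, l, p, q, r). i < j \<and> j < l \<and> l < k \<and> p \<in> C i \<and> q \<in> C j \<and> r \<in> C l \<and>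
               bad p q r} \<le> k * S ^ 3"
  obtains f J where "J \<subseteq> {..<k}" "k \<le> 2 * card J" "\<And>i. i \<in> J \<Longrightarrow> f i \<in> C i"
    "\<And>i j l. \<lbrakk>i \<in> J; j \<in> J; l \<in> J; i < j; j < l\<rbrakk> \<Longrightarrow> \<not> bad (f i) (f j) (f l)"
proof -
  define T where "T = {(i, j, l, p, q, r). i < j \<and> j < l \<and> l < k \<and> p \<in> C i \<and> q \<in> C j \<and> r \<in> C l \<and> bad p q r}"
  have finC: "finite (C i)" if "i < k" for i using cardC[OF that] \<open>S > 0\<close> card_ge_0_finite by metis
  define V where "V = (\<Union>i<k. C i)"
  have "finite V" unfolding V_def using finC by auto
  have "T \<subseteq> {..<k} \<times> {..<k} \<times> {..<k} \<times> V \<times> V \<times> V" unfolding T_def V_def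
    by (auto intro: order.strict_trans)
  then have "finite T" by (rule finite_subset) (simp add: \<open>finite V\<close>)
  define F where "F = (\<Pi>\<^sub>E i\<in>{..<k}. C i)"
  have "finite F" unfolding F_def using finC by (auto intro: finite_PiE)
  have cardF: "card F = S ^ k" unfolding F_def by (simp add: card_PiE cardC)
  define E where "E f = {(i, j, l). i < j \<and> j < l \<and> l < k \<and> bad (f i) (f j) (f l)}" for f
  have finE: "finite (E f)" for f
    by (rule finite_subset[of _ "{..<k} \<times> {..<k} \<times> {..<k}"]) (auto simp: E_def)
  define agrees where "agrees f \<tau> = (case \<tau> of (i, j, l, p, q, r) \<Rightarrow> f i = p \<and> f j = q \<and> f l = r)"
    for f :: "nat \<Rightarrow> 'a" and \<tau> :: "nat \<times> nat \<times> nat \<times> 'a \<times> 'a \<times> 'a"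
  have E_le: "card (E f) \<le> card {\<tau>\<in>T. agrees f \<tau>}" if "f \<in> F" for f
  proof (rule card_inj_on_le)
    show "inj_on (\<lambda>(i, j, l). (i, j, l, f i, f j, f l)) (E f)" by (auto intro: inj_onI)
    show "(\<lambda>(i, j, l). (i, j, l, f i, f j, f l)) ` E f \<subseteq> {\<tau>\<in>T. agrees f \<tau>}"
      using that unfolding E_def T_def agrees_def F_def by (auto simp: PiE_def Pi_def)
    show "finite {\<tau>\<in>T. agrees f \<tau>}" using \<open>finite T\<close> by simp
  qed
  have agree_card: "card {f\<in>F. agrees f \<tau>} * S ^ 3 = S ^ k" if \<tau>: "\<tau> \<in> T" for \<tau>
  proof -
    obtain i j l p q r where t: "\<tau> = (i, j, l, p, q, r)" by (metis surj_pair)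
    then have ijl: "i < j" "j < l" "l < k" "p \<in> C i" "q \<in> C j" "r \<in> C l"
      using \<tau> unfolding T_def by auto
    \<comment> \<open>Agreeing with a fixed triple means that three of the factors shrink to
      singletons, leaving \<open>S ^ (k - 3)\<close> choices.\<close>
    define D where "D = C(i := {p}, j := {q}, l := {r})"
    have "{f\<in>F. agrees f \<tau>} = (\<Pi>\<^sub>E h\<in>{..<k}. D h)"
    proof (intro set_eqI iffI)
      fix f assume "f \<in> {f\<in>F. agrees f \<tau>}"
      then have f: "f \<in> extensional {..<k}" "\<forall>h\<in>{..<k}. f h \<in> C h" "f i = p" "f j = q" "f l = r"
        unfolding t agrees_def F_def PiE_iff by simp_all
      then have "f h \<in> D h" if "h < k" for h using that unfolding D_def by simp
      then show "f \<in> (\<Pi>\<^sub>E h\<in>{..<k}. D h)" using f(1) unfolding PiE_iff by simp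
    next
      fix f assume "f \<in> (\<Pi>\<^sub>E h\<in>{..<k}. D h)"
      then have f: "f \<in> extensional {..<k}" "\<And>h. h < k \<Longrightarrow> f h \<in> D h" unfolding PiE_iff by simp_all
      have "D h \<subseteq> C h" for h using ijl unfolding D_def by simp
      then have "f h \<in> C h" if "h < k" for h using f(2)[OF that] by blast
      moreover have "f i = p" "f j = q" "f l = r"
        using f(2)[of i] f(2)[of j] f(2)[of l] ijl unfolding D_def by simp_all
      ultimately show "f \<in> {f\<in>F. agrees f \<tau>}"
        using f(1) unfolding t agrees_def F_def PiE_iff by simp
    qed
    then have "card {f\<in>F. agrees f \<tau>} = (\<Prod>h<k. card (D h))" by (simp add: card_PiE)
    also have "\<dots> = (\<Prod>h\<in>{..<k} - {i, j, l}. card (D h)) * (\<Prod>h\<in>{i, j, l}. card (D h))"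
      using ijl by (intro prod.subset_diff) auto
    also have "(\<Prod>h\<in>{i, j, l}. card (D h)) = 1" using ijl unfolding D_def by simp
    also have "(\<Prod>h\<in>{..<k} - {i, j, l}. card (D h)) = (\<Prod>h\<in>{..<k} - {i, j, l}. S)"
      unfolding D_def by (intro prod.cong) (auto simp: cardC)
    also have "\<dots> = S ^ (k - 3)"
    proof -
      have "card ({..<k} - {i, j, l}) = k - 3" using ijl by (subst card_Diff_subset) auto
      then show ?thesis by simp
    qed
    finally have "card {f\<in>F. agrees f \<tau>} = S ^ (k - 3)" by simp
    moreover have "k \<ge> 3" using ijl by linarith
    ultimately show ?thesis by (simp flip: power_add)
  qed
  have "(\<Sum>f\<in>F. card (E f)) * S ^ 3 \<le> (\<Sum>f\<in>F. card {\<tau>\<in>T. agrees f \<tau>}) * S ^ 3"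
    by (intro mult_right_mono sum_mono E_le) auto
  \<comment> \<open>Double counting of the agreeing pairs of a choice function and a bad
    triple.\<close>
  also have "(\<Sum>f\<in>F. card {\<tau>\<in>T. agrees f \<tau>}) = (\<Sum>\<tau>\<in>T. card {f\<in>F. agrees f \<tau>})"
    using sum.swap_restrict[OF \<open>finite F\<close> \<open>finite T\<close>, of "\<lambda>_ _. 1::nat" agrees] by simp
  also have "\<dots> * S ^ 3 = card T * S ^ k"
    unfolding sum_distrib_right using agree_card by simp
  finally have "2 * ((\<Sum>f\<in>F. card (E f)) * S ^ 3) \<le> (2 * card T) * S ^ k" by simp
  also have "\<dots> \<le> (k * S ^ 3) * S ^ k" using few unfolding T_def by (intro mult_right_mono) auto
  finally have "(2 * (\<Sum>f\<in>F. card (E f))) * S ^ 3 \<le> (k * S ^ k) * S ^ 3" by (simp add: ac_simps)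
  then have tot: "2 * (\<Sum>f\<in>F. card (E f)) \<le> k * S ^ k" using \<open>S > 0\<close> by simp
  have "\<exists>f\<in>F. 2 * card (E f) \<le> k"
  proof (rule ccontr)
    assume "\<not> ?thesis"
    then have "k < 2 * card (E f)" if "f \<in> F" for f using that by auto
    moreover have "F \<noteq> {}" using cardF \<open>S > 0\<close> by auto
    ultimately have "(\<Sum>f\<in>F. k) < (\<Sum>f\<in>F. 2 * card (E f))"
      using \<open>finite F\<close> by (intro sum_strict_mono) auto
    then show False using tot cardF by (simp add: sum_distrib_left mult.commute)
  qed
  then obtain f where f: "f \<in> F" "2 * card (E f) \<le> k" by blast
  \<comment> \<open>Dropping the smallest index of every bad triple destroys all of them and costs
    at most \<open>card (E f)\<close> indices.\<close>
  define J where "J = {..<k} - fst ` E f"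
  have "card {..<k} - card (fst ` E f) \<le> card J"
    unfolding J_def using finE by (intro diff_card_le_card_Diff) auto
  moreover have "card (fst ` E f) \<le> card (E f)" using finE by (rule card_image_le)
  ultimately have "k \<le> 2 * card J" using f(2) by simp
  show ?thesis
  proof (rule that[of J f])
    show "J \<subseteq> {..<k}" unfolding J_def by blast
    show "f i \<in> C i" if "i \<in> J" for i using that f(1) unfolding F_def J_def by (auto simp: PiE_iff)
    show "\<not> bad (f i) (f j) (f l)" if "i \<in> J" "j \<in> J" "l \<in> J" "i < j" "j < l" for i j l
    proof
      assume "bad (f i) (f j) (f l)"
      then have "(i, j, l) \<in> E f" using that unfolding J_def E_def by simp
      then have "i \<in> fst ` E f" by (metis fst_conv imageI)
      then show False using that(1) unfolding J_def by simp
    qed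
  qed fact
qed

section \<open>Elementary sums for the triple count\<close>

lemma sum_inverse_sqrt_le: "(\<Sum>a=1..m. 1 / sqrt (real a)) \<le> 2 * sqrt (real m)"
proof (induction m)
  case (Suc m)
  define u where "u = sqrt (real m)"
  define v where "v = sqrt (real (Suc m))"
  have uv: "u \<ge> 0" "v > 0" "u \<le> v" "v * v = u * u + 1" unfolding u_def v_def by auto
  have "1 / v \<le> 2 * v - 2 * u"
  proof -
    have "1 = (v - u) * (v + u)" using uv(4) by (simp add: algebra_simps)
    also have "\<dots> \<le> (v - u) * (2 * v)" using uv by (intro mult_left_mono) auto
    finally show ?thesis using uv(2) by (simp add: field_simps)
  qed
  then show ?case using Suc.IH by (simp add: u_def v_def)
qed simp

text \<open>A discrete Beta integral. With \<open>u\<close> and \<open>v\<close> the two roots,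
  \<open>1 / (u * v) = (1 / u + 1 / v) / (u + v)\<close> and \<open>u + v \<ge> sqrt m\<close>; by
  symmetry two copies of the single-root sum remain.\<close>

lemma sum_inverse_sqrt_prod_le:
  "(\<Sum>a=1..<m. 1 / sqrt (real a * real (m - a))) \<le> 4"
proof (cases "m = 0")
  case False
  have term_le: "1 / sqrt (real a * real (m - a)) \<le> (1 / sqrt (real a) + 1 / sqrt (real (m - a))) / sqrt (real m)"
    if "a \<in> {1..<m}" for a
  proof -
    define u where "u = sqrt (real a)"
    define v where "v = sqrt (real (m - a))"
    have uv: "u > 0" "v > 0" using that unfolding u_def v_def by auto
    have "sqrt (real m) \<le> u + v"
      unfolding u_def v_def using that sqrt_add_le_add_sqrt[of "real a" "real (m - a)"] by (simp add: of_nat_diff)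
    moreover have "sqrt (real m) > 0" using False by simp
    moreover have "1 / (u * v) = (1 / u + 1 / v) / (u + v)" using uv by (simp add: divide_simps)
    ultimately have "1 / (u * v) \<le> (1 / u + 1 / v) / sqrt (real m)"
      using uv by (simp add: divide_left_mono)
    then show ?thesis by (simp add: u_def v_def real_sqrt_mult)
  qed
  have "(\<Sum>a=1..<m. 1 / sqrt (real (m - a))) = (\<Sum>a=1..<m. 1 / sqrt (real a))"
    by (rule sum.reindex_bij_witness[of _ "\<lambda>a. m - a" "\<lambda>a. m - a"]) auto
  moreover have "(\<Sum>a=1..<m. 1 / sqrt (real a)) \<le> (\<Sum>a=1..m. 1 / sqrt (real a))"
    by (intro sum_mono2) auto
  ultimately have "(\<Sum>a=1..<m. 1 / sqrt (real a) + 1 / sqrt (real (m - a))) \<le> 4 * sqrt (real m)"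
    using sum_inverse_sqrt_le[of m] by (simp add: sum.distrib)
  then have "(\<Sum>a=1..<m. (1 / sqrt (real a) + 1 / sqrt (real (m - a))) / sqrt (real m)) \<le> 4"
    using False by (simp add: divide_le_eq flip: sum_divide_distrib)
  then show ?thesis using sum_mono[OF term_le, of "{1..<m}" "\<lambda>a. a"] by linarith
qed simp

lemma sum_inverse_le_ln:
  assumes "n > 0" shows "(\<Sum>m=1..n. 1 / real m) \<le> 1 + ln (real n)"
proof -
  have "harm n - ln n \<le> harm 1 - ln 1"
    using decseq_harm_diff_ln assms
    by (metis (mono_tags, lifting) One_nat_def Suc_pred decseqD of_nat_1 zero_le)
  then show ?thesis unfolding harm_def by (simp add: inverse_eq_divide)
qed

section \<open>Collinear triples near a parabola\<close>

definition parabola :: "nat \<Rightarrow> int \<Rightarrow> real" where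
  "parabola X x = of_int x + (of_int x)\<^sup>2 / X"

text \<open>The half-width \<open>4 * s\<close> is chosen to contain whole cells of side
  \<open>s\<close>, see \<open>cell_subset_strip\<close>.\<close>

definition parabola_strip :: "nat \<Rightarrow> nat \<Rightarrow> (int \<times> int) set" where
  "parabola_strip X s = {(x, y). 0 \<le> x \<and> x < int X \<and> \<bar>of_int y - parabola X x\<bar> \<le> 4 * s}"

definition int_collinear :: "int \<times> int \<Rightarrow> int \<times> int \<Rightarrow> int \<times> int \<Rightarrow> bool" where
  "int_collinear p q r \<longleftrightarrow> (fst q - fst p) * (snd r - snd p) = (fst r - fst p) * (snd q - snd p)"

text \<open>The gap of at least \<open>s\<close> between the outer points lets the vertical errors
  of size \<open>8 * s\<close> be absorbed into a multiple of the horizontal step.\<close>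

definition strip_triples :: "nat \<Rightarrow> nat \<Rightarrow> ((int \<times> int) \<times> (int \<times> int) \<times> (int \<times> int)) set" where
  "strip_triples X s = {(p, q, r). p \<in> parabola_strip X s \<and> q \<in> parabola_strip X s \<and>
     r \<in> parabola_strip X s \<and> fst p < fst q \<and> fst q < fst r \<and> int s \<le> fst r - fst p \<and> int_collinear p q r}"

text \<open>Dividing the longer vector by the gcd \<open>m\<close> of its coordinates leaves a
  primitive vector \<open>(a, b)\<close>, and every parallel integer vector is an integer multiple
  of a primitive one.\<close>

lemma parallel_int_vectors:
  fixes d e d' e' :: int
  assumes "0 < d'" "d' < d" "d' * e = d * e'"
  obtains m \<alpha> :: nat and a b :: int where "1 \<le> \<alpha>" "\<alpha> < m" "1 \<le> a"
    "d = int m * a" "e = int m * b" "d' = int \<alpha> * a" "e' = int \<alpha> * b"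
proof -
  define g where "g = gcd d e"
  have "g > 0" using assms unfolding g_def by simp
  obtain a b where ab: "d = g * a" "e = g * b" "coprime a b"
    using gcd_coprime_exists[of d e] \<open>g > 0\<close> unfolding g_def by (metis less_irrefl mult.commute)
  have "a > 0" using ab(1) assms \<open>g > 0\<close> by (smt (verit) zero_less_mult_pos)
  have eq: "d' * b = a * e'" using assms(3) \<open>g > 0\<close> unfolding ab by simp
  then have "a dvd d' * b" by simp
  then have "a dvd d'" using ab(3) coprime_dvd_mult_left_iff by blast
  then obtain c where c: "d' = a * c" by blast
  have "c > 0" using c assms(1) \<open>a > 0\<close> by (smt (verit) zero_less_mult_pos)
  have "c < g" using assms(2) \<open>a > 0\<close> unfolding c ab(1) by simp
  have "e' = c * b" using eq \<open>a > 0\<close> unfolding c by simp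
  show ?thesis
    by (rule that[of "nat c" "nat g" a b]) (use \<open>c > 0\<close> \<open>c < g\<close> \<open>g > 0\<close> \<open>a > 0\<close> ab c \<open>e' = c * b\<close> in auto)
qed

lemma parabola_increment:
  "X > 0 \<Longrightarrow> parabola X (x + d) - parabola X x = of_int d + (2 * of_int x * of_int d + (of_int d)\<^sup>2) / X"
  unfolding parabola_def by (simp add: field_simps power2_eq_square)

text \<open>The parabola lies \<open>a\<^sup>2 \<alpha> (m - \<alpha>) / X\<close> below its chord at the middle point, while all three
  points are within \<open>4 s\<close> of it.\<close>

lemma parabola_strip_three_points:
  fixes m \<alpha> X s :: nat and a b x y :: int
  assumes "X > 0" "\<alpha> < m"
    and "(x, y) \<in> parabola_strip X s"
    and "(x + int \<alpha> * a, y + int \<alpha> * b) \<in> parabola_strip X s"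
    and "(x + int m * a, y + int m * b) \<in> parabola_strip X s"
  shows "(of_int a)\<^sup>2 * (real \<alpha> * real (m - \<alpha>)) \<le> 8 * real s * X"
proof -
  define e0 where "e0 = of_int y - parabola X x"
  define e1 where "e1 = of_int (y + int \<alpha> * b) - parabola X (x + int \<alpha> * a)"
  define e2 where "e2 = of_int (y + int m * b) - parabola X (x + int m * a)"
  have e: "\<bar>e0\<bar> \<le> 4 * s" "\<bar>e1\<bar> \<le> 4 * s" "\<bar>e2\<bar> \<le> 4 * s"
    using assms unfolding parabola_strip_def e0_def e1_def e2_def by auto
  \<comment> \<open>These weights annihilate affine functions along the line, so \<open>y\<close>,
    \<open>b\<close> and the linear part of the parabola drop out and only the quadratic term
    survives.\<close>
  have "m * e1 - (m - \<alpha>) * e0 - \<alpha> * e2 = m * ((of_int a)\<^sup>2 * (real \<alpha> * real (m - \<alpha>)) / X)"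
    using assms(1,2) unfolding e0_def e1_def e2_def parabola_def
    by (simp add: of_nat_diff field_simps power2_eq_square)
  moreover have "m * e1 - (m - \<alpha>) * e0 - \<alpha> * e2 \<le> m * (8 * real s)"
  proof -
    have "m * e1 \<le> m * (4 * real s)" using e by (intro mult_left_mono) auto
    moreover have "real (m - \<alpha>) * (- e0) \<le> real (m - \<alpha>) * (4 * real s)" using e by (intro mult_left_mono) auto
    moreover have "\<alpha> * (- e2) \<le> \<alpha> * (4 * real s)" using e by (intro mult_left_mono) auto
    moreover have "real (m - \<alpha>) * (4 * real s) + \<alpha> * (4 * real s) = m * (4 * real s)"
      using assms(2) by (simp add: of_nat_diff algebra_simps)
    ultimately show ?thesis by (simp add: algebra_simps)
  qed
  ultimately have "m * ((of_int a)\<^sup>2 * (real \<alpha> * real (m - \<alpha>)) / X) \<le> m * (8 * real s)" by simp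
  then have "(of_int a)\<^sup>2 * (real \<alpha> * real (m - \<alpha>)) / X \<le> 8 * real s"
    using assms(2) by (metis gr_implies_not0 mult_le_cancel_left_pos neq0_conv of_nat_0_less_iff)
  then show ?thesis using assms(1) by (simp add: divide_le_eq)
qed

text \<open>A collinear triple is written as \<open>p\<close>, \<open>p + \<alpha> (a, b)\<close>, \<open>p + m (a, b)\<close> with \<open>0 < \<alpha> < m\<close>. Once
  \<open>m\<close> and \<open>\<alpha>\<close> are fixed, the next four sets confine \<open>a\<close>, then \<open>b\<close>, then the coordinates of \<open>p\<close>.\<close>

definition step_lengths :: "nat \<Rightarrow> nat \<Rightarrow> nat \<Rightarrow> nat \<Rightarrow> int set" where
  "step_lengths X s m \<alpha> = {a. 1 \<le> a \<and> (of_int a)\<^sup>2 * (real \<alpha> * real (m - \<alpha>)) \<le> 8 * real s * X \<and>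
     int s \<le> int m * a \<and> int m * a \<le> int X}"

definition step_heights :: "int \<Rightarrow> int set" where
  "step_heights a = {b. \<bar>real_of_int b - 2 * of_int a\<bar> \<le> 9 * of_int a}"

definition base_abscissae :: "nat \<Rightarrow> nat \<Rightarrow> nat \<Rightarrow> int \<Rightarrow> int \<Rightarrow> int set" where
  "base_abscissae X s m a b =
     {x. \<bar>of_int (int m * b) - (parabola X (x + int m * a) - parabola X x)\<bar> \<le> 8 * real s}"

definition base_ordinates :: "nat \<Rightarrow> nat \<Rightarrow> int \<Rightarrow> int set" where
  "base_ordinates X s x = {y. \<bar>of_int y - parabola X x\<bar> \<le> 4 * real s}"

lemma strip_triples_subset:
  assumes "X > 0"
  shows "strip_triples X s \<subseteq>
    (\<lambda>(m, \<alpha>, a, b, x, y). ((x, y), (x + int \<alpha> * a, y + int \<alpha> * b), (x + int m * a, y + int m * b))) `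
      (SIGMA m:{1..X}. SIGMA \<alpha>:{1..<m}. SIGMA a:step_lengths X s m \<alpha>. SIGMA b:step_heights a.
         SIGMA x:base_abscissae X s m a b. base_ordinates X s x)"
    (is "_ \<subseteq> ?\<phi> ` ?Z")
proof
  fix t assume "t \<in> strip_triples X s"
  then obtain x y x' y' x'' y'' where t: "t = ((x, y), (x', y'), (x'', y''))"
    and W: "(x, y) \<in> parabola_strip X s" "(x', y') \<in> parabola_strip X s" "(x'', y'') \<in> parabola_strip X s"
    and lt: "x < x'" "x' < x''" "int s \<le> x'' - x"
    and col: "(x' - x) * (y'' - y) = (x'' - x) * (y' - y)"
    unfolding strip_triples_def int_collinear_def by auto
  obtain m \<alpha> a b where P: "1 \<le> \<alpha>" "\<alpha> < m" "1 \<le> a" "x'' - x = int m * a" "y'' - y = int m * b"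
      "x' - x = int \<alpha> * a" "y' - y = int \<alpha> * b"
    by (rule parallel_int_vectors[of "x' - x" "x'' - x" "y'' - y" "y' - y"]) (use lt col in auto)
  have eqs: "x' = x + int \<alpha> * a" "y' = y + int \<alpha> * b" "x'' = x + int m * a" "y'' = y + int m * b"
    using P by auto
  have x: "0 \<le> x" "x'' < int X" using W unfolding parabola_strip_def by auto
  define d where "d = int m * a"
  have d: "1 \<le> d" "d \<le> int X" "int s \<le> d" using x lt P(4) unfolding d_def by auto
  have "int m * 1 \<le> int m * a" using P(3) by (intro mult_left_mono) auto
  then have "int m \<le> int X" using d unfolding d_def by simp
  then have "m \<in> {1..X}" using P by simp
  moreover have "\<alpha> \<in> {1..<m}" using P by simp
  moreover have "a \<in> step_lengths X s m \<alpha>"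
    using parabola_strip_three_points[OF assms P(2) W[unfolded eqs]] P(3) d
    unfolding step_lengths_def d_def by simp
  moreover have "y \<in> base_ordinates X s x"
    using W unfolding parabola_strip_def base_ordinates_def by auto
  moreover have xb: "x \<in> base_abscissae X s m a b"
  proof -
    have "\<bar>of_int y - parabola X x\<bar> \<le> 4 * real s" "\<bar>of_int (y + int m * b) - parabola X (x + int m * a)\<bar> \<le> 4 * real s"
      using W unfolding parabola_strip_def eqs by auto
    then show ?thesis unfolding base_abscissae_def by simp
  qed
  \<comment> \<open>The parabola rises by between \<open>d\<close> and \<open>3 * d\<close> over a
    step \<open>d = m * a\<close>, thus by \<open>2 * d\<close> up to \<open>d\<close>; the strip
    adds an error \<open>8 * s \<le> 8 * d\<close>. Dividing by \<open>m\<close> gives the bound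
    \<open>9 * a\<close>.\<close>
  moreover have "b \<in> step_heights a"
  proof -
    let ?D = "parabola X (x + d) - parabola X x"
    have r: "0 \<le> real_of_int x" "real_of_int x + real_of_int d \<le> real X" "1 \<le> real_of_int d" "real s \<le> real_of_int d"
      using x d P(4) unfolding d_def by linarith+
    have "0 \<le> (2 * of_int x * of_int d + (of_int d)\<^sup>2) / real X" using r by simp
    moreover have "(2 * of_int x * of_int d + (of_int d)\<^sup>2) / real X \<le> 2 * of_int d"
    proof -
      have "(2 * of_int x + of_int d) * of_int d \<le> (2 * real X) * of_int d"
        using r by (intro mult_right_mono) auto
      then show ?thesis using assms by (simp add: divide_le_eq power2_eq_square algebra_simps)
    qed
    ultimately have "\<bar>?D - 2 * of_int d\<bar> \<le> of_int d" unfolding parabola_increment[OF assms] by simp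
    moreover have "\<bar>of_int (int m * b) - ?D\<bar> \<le> 8 * real s" using xb unfolding base_abscissae_def d_def by simp
    ultimately have "\<bar>of_int (int m * b) - 2 * of_int d\<bar> \<le> 9 * real_of_int d" using r by linarith
    then have "\<bar>real m * (of_int b - 2 * of_int a)\<bar> \<le> real m * (9 * of_int a)"
      unfolding d_def by (simp add: algebra_simps)
    then have "real m * \<bar>of_int b - 2 * of_int a\<bar> \<le> real m * (9 * of_int a)" by (simp add: abs_mult)
    then show ?thesis unfolding step_heights_def using P(1,2) by (simp add: mult_le_cancel_left)
  qed
  ultimately have "(m, \<alpha>, a, b, x, y) \<in> ?Z" by blast
  then show "t \<in> ?\<phi> ` ?Z" unfolding t eqs by (rule rev_image_eqI) simp
qed

lemma card_base_ordinates:
  assumes "s > 0"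
  shows "finite (base_ordinates X s x)" and "real (card (base_ordinates X s x)) \<le> 9 * real s"
proof -
  have "\<bar>of_int y - parabola X x\<bar> \<le> 4 * real s" if "y \<in> base_ordinates X s x" for y
    using that unfolding base_ordinates_def by simp
  note * = card_int_set_le[OF this]
  show "finite (base_ordinates X s x)" by (rule *(1)) auto
  have "real (card (base_ordinates X s x)) \<le> 2 * (4 * real s) + 1" by (rule *(2)) auto
  then show "real (card (base_ordinates X s x)) \<le> 9 * real s" using assms by linarith
qed

text \<open>The increment of the parabola over a fixed step \<open>d = m * a\<close> is affine in
  \<open>x\<close> with slope \<open>2 * d / X\<close>, so a tolerance of \<open>8 * s\<close>
  confines \<open>x\<close> to a radius of \<open>4 * s * X / d\<close>.\<close>

lemma card_base_abscissae:
  assumes "s > 0" "X > 0" "a \<in> step_lengths X s m \<alpha>" "m > 0"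
  shows "finite (base_abscissae X s m a b)"
    and "real (card (base_abscissae X s m a b)) \<le> 9 * real s * real X / (real m * of_int a)"
proof -
  define d where "d = real m * of_int a"
  have a: "1 \<le> a" "int m * a \<le> int X" using assms(3) unfolding step_lengths_def by auto
  have "d > 0" using a assms(4) unfolding d_def by simp
  have "d = real_of_int (int m * a)" unfolding d_def by simp
  then have "d \<le> X" using a(2) by linarith
  define c where "c = (real m * of_int b - d - d\<^sup>2 / X) * X / (2 * d)"
  have dist: "\<bar>of_int x - c\<bar> \<le> 4 * real s * real X / d" if "x \<in> base_abscissae X s m a b" for x
  proof -
    have "\<bar>real m * of_int b - (d + (2 * of_int x * d + d\<^sup>2) / X)\<bar> \<le> 8 * real s"
      using that parabola_increment[OF assms(2), of x "int m * a"]
      unfolding base_abscissae_def d_def by simp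
    moreover have "real m * of_int b - (d + (2 * of_int x * d + d\<^sup>2) / X) = (c - of_int x) * (2 * d / X)"
      unfolding c_def using \<open>d > 0\<close> assms(2) by (simp add: field_simps)
    ultimately have "\<bar>c - of_int x\<bar> * (2 * d / X) \<le> 8 * real s"
      using \<open>d > 0\<close> by (simp add: abs_mult)
    then show ?thesis using \<open>d > 0\<close> assms(2) by (simp add: field_simps abs_minus_commute)
  qed
  have "4 * real s * real X / d \<ge> 0" using \<open>d > 0\<close> by simp
  note * = card_int_set_le[OF dist this]
  show "finite (base_abscissae X s m a b)" by (rule *(1))
  have "1 * 1 \<le> real s * (X / d)" using assms(1) \<open>d \<le> X\<close> \<open>d > 0\<close> by (intro mult_mono) auto
  then have le: "2 * (4 * real s * real X / d) + 1 \<le> 9 * real s * real X / d" using \<open>d > 0\<close> by (simp add: field_simps)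
  show "real (card (base_abscissae X s m a b)) \<le> 9 * real s * real X / (real m * of_int a)"
    unfolding d_def[symmetric] by (rule order_trans[OF *(2) le])
qed

lemma card_step_heights:
  assumes "1 \<le> a"
  shows "finite (step_heights a)" and "real (card (step_heights a)) \<le> 19 * of_int a"
proof -
  have "\<bar>of_int b - 2 * of_int a\<bar> \<le> 9 * real_of_int a" if "b \<in> step_heights a" for b
    using that unfolding step_heights_def by simp
  note * = card_int_set_le[OF this]
  show "finite (step_heights a)" by (rule *(1)) (use assms in auto)
  have "real (card (step_heights a)) \<le> 2 * (9 * of_int a) + 1" by (rule *(2)) (use assms in auto)
  then show "real (card (step_heights a)) \<le> 19 * of_int a" using assms by linarith
qed

lemma card_step_lengths:
  assumes "\<alpha> \<in> {1..<m}"
  shows "finite (step_lengths X s m \<alpha>)"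
    and "real (card (step_lengths X s m \<alpha>)) \<le> sqrt (8 * real s * X) * (1 / sqrt (real \<alpha> * real (m - \<alpha>)))"
proof -
  define R where "R = sqrt (8 * real s * X) * (1 / sqrt (real \<alpha> * real (m - \<alpha>)))"
  have "R \<ge> 0" unfolding R_def by simp
  \<comment> \<open>Since \<open>a \<ge> 1\<close>, the count is at most \<open>R\<close> itself,
    also when \<open>R < 1\<close>. An additive 1, as in \<open>card_int_set_le\<close>, would be
    paid for every pair \<open>m\<close>, \<open>\<alpha>\<close>.\<close>
  have "step_lengths X s m \<alpha> \<subseteq> {1..\<lfloor>R\<rfloor>}"
  proof
    fix a assume a: "a \<in> step_lengths X s m \<alpha>"
    have pos: "real \<alpha> * real (m - \<alpha>) > 0" using assms by simp
    have "sqrt ((of_int a)\<^sup>2 * (real \<alpha> * real (m - \<alpha>))) \<le> sqrt (8 * real s * X)"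
      using a unfolding step_lengths_def by (intro real_sqrt_le_mono) auto
    then have "of_int a * sqrt (real \<alpha> * real (m - \<alpha>)) \<le> sqrt (8 * real s * X)"
      using a unfolding step_lengths_def real_sqrt_mult[of "(of_int a)\<^sup>2"] by simp
    moreover have "sqrt (real \<alpha> * real (m - \<alpha>)) > 0" using pos by (rule real_sqrt_gt_zero)
    ultimately have "of_int a \<le> R" unfolding R_def
      by (metis mult.right_neutral pos_le_divide_eq times_divide_eq_right)
    then show "a \<in> {1..\<lfloor>R\<rfloor>}" using a unfolding step_lengths_def by (simp add: le_floor_iff)
  qed
  then show "finite (step_lengths X s m \<alpha>)" and "real (card (step_lengths X s m \<alpha>)) \<le> sqrt (8 * real s * X) * (1 / sqrt (real \<alpha> * real (m - \<alpha>)))"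
    using finite_subset[of _ "{1..\<lfloor>R\<rfloor>}"] card_mono[of "{1..\<lfloor>R\<rfloor>}" "step_lengths X s m \<alpha>"] \<open>R \<ge> 0\<close>
    unfolding R_def[symmetric] by (auto, linarith)
qed

lemma card_Sigma_le:
  fixes c :: real
  assumes "finite A" "\<And>a. a \<in> A \<Longrightarrow> finite (B a)" "\<And>a. a \<in> A \<Longrightarrow> real (card (B a)) \<le> c"
  shows "real (card (SIGMA a:A. B a)) \<le> card A * c"
proof -
  have "real (card (SIGMA a:A. B a)) = (\<Sum>a\<in>A. real (card (B a)))" using assms(1,2) by simp
  also have "\<dots> \<le> card A * c" using assms(3) by (intro sum_bounded_above) auto
  finally show ?thesis .
qed

text \<open>The nested counts multiply, and the factor \<open>a\<close> from the heights cancels the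
  \<open>1 / a\<close> from the abscissae. The sum over \<open>\<alpha>\<close> is then bounded by 4
  and the sum over \<open>m\<close> is harmonic, which is the source of the logarithm.\<close>

lemma card_strip_triples:
  assumes "s > 0" "X > 0"
  shows "finite (strip_triples X s)"
    and "real (card (strip_triples X s)) \<le> 20000 * (real s)\<^sup>2 * real X * sqrt (real s * X) * (1 + ln X)"
proof -
  let ?Y = "\<lambda>x. base_ordinates X s x"
  let ?X = "\<lambda>m a b. SIGMA x:base_abscissae X s m a b. ?Y x"
  let ?B = "\<lambda>m a. SIGMA b:step_heights a. ?X m a b"
  let ?A = "\<lambda>m \<alpha>. SIGMA a:step_lengths X s m \<alpha>. ?B m a"
  let ?M = "\<lambda>m. SIGMA \<alpha>:{1..<m}. ?A m \<alpha>"
  \<comment> \<open>Here 1539 is \<open>19 * 9 * 9\<close>, from heights, abscissae and ordinates.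
    At the end \<open>4 * 1539 * 3 = 18468\<close> is rounded up to 20000, with 3 standing for
    \<open>sqrt 8\<close>.\<close>
  define K where "K = 1539 * (real s)\<^sup>2 * real X * sqrt (8 * real s * X)"
  have "K \<ge> 0" unfolding K_def by simp
  have fX: "finite (?X m a b)" and cX: "real (card (?X m a b)) \<le> 81 * (real s)\<^sup>2 * real X / (real m * of_int a)"
    if a: "a \<in> step_lengths X s m \<alpha>" and m: "m > 0" for m \<alpha> a b
  proof -
    note 1 = card_base_abscissae[OF assms a m, of b]
    show "finite (?X m a b)" by (rule finite_SigmaI[OF 1(1) card_base_ordinates(1)[OF assms(1)]])
    have "real (card (?X m a b)) \<le> card (base_abscissae X s m a b) * (9 * real s)"
      by (rule card_Sigma_le[OF 1(1) card_base_ordinates[OF assms(1)]])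
    also have "\<dots> \<le> 9 * real s * real X / (real m * of_int a) * (9 * real s)"
      using 1(2) by (intro mult_right_mono) auto
    finally show "real (card (?X m a b)) \<le> 81 * (real s)\<^sup>2 * real X / (real m * of_int a)"
      by (simp add: power2_eq_square algebra_simps)
  qed
  have fB: "finite (?B m a)" and cB: "real (card (?B m a)) \<le> 1539 * (real s)\<^sup>2 * real X / real m"
    if a: "a \<in> step_lengths X s m \<alpha>" and m: "m > 0" for m \<alpha> a
  proof -
    have "1 \<le> a" using a unfolding step_lengths_def by simp
    note 1 = card_step_heights[OF this]
    show "finite (?B m a)" by (rule finite_SigmaI[OF 1(1) fX[OF a m]])
    have "real (card (?B m a)) \<le> card (step_heights a) * (81 * (real s)\<^sup>2 * real X / (real m * of_int a))"
      by (rule card_Sigma_le[OF 1(1) fX[OF a m] cX[OF a m]])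
    also have "\<dots> \<le> (19 * of_int a) * (81 * (real s)\<^sup>2 * real X / (real m * of_int a))"
      using 1(2) \<open>1 \<le> a\<close> by (intro mult_right_mono) auto
    also have "\<dots> = 1539 * (real s)\<^sup>2 * real X / real m" using \<open>1 \<le> a\<close> m by (simp add: field_simps)
    finally show "real (card (?B m a)) \<le> 1539 * (real s)\<^sup>2 * real X / real m" .
  qed
  have fA: "finite (?A m \<alpha>)" and cA: "real (card (?A m \<alpha>)) \<le> K / m * (1 / sqrt (real \<alpha> * real (m - \<alpha>)))"
    if \<alpha>: "\<alpha> \<in> {1..<m}" for m \<alpha>
  proof -
    have m: "m > 0" using \<alpha> by simp
    note 1 = card_step_lengths[OF \<alpha>, of X s]
    show "finite (?A m \<alpha>)" by (rule finite_SigmaI[OF 1(1) fB[OF _ m]])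
    have "real (card (?A m \<alpha>)) \<le> card (step_lengths X s m \<alpha>) * (1539 * (real s)\<^sup>2 * real X / real m)"
      by (rule card_Sigma_le[OF 1(1) fB[OF _ m] cB[OF _ m]])
    also have "\<dots> \<le> (sqrt (8 * real s * X) * (1 / sqrt (real \<alpha> * real (m - \<alpha>)))) * (1539 * (real s)\<^sup>2 * real X / real m)"
      using 1(2) by (intro mult_right_mono) auto
    finally show "real (card (?A m \<alpha>)) \<le> K / m * (1 / sqrt (real \<alpha> * real (m - \<alpha>)))"
      unfolding K_def by (simp add: mult_ac)
  qed
  have fM: "finite (?M m)" for m by (rule finite_SigmaI[OF _ fA]) auto
  have cM: "real (card (?M m)) \<le> 4 * K * (1 / m)" for m
  proof -
    have "real (card (?M m)) = (\<Sum>\<alpha>=1..<m. real (card (?A m \<alpha>)))" using fA by simp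
    also have "\<dots> \<le> (\<Sum>\<alpha>=1..<m. K / m * (1 / sqrt (real \<alpha> * real (m - \<alpha>))))"
      using cA by (intro sum_mono)
    also have "\<dots> = K / m * (\<Sum>\<alpha>=1..<m. 1 / sqrt (real \<alpha> * real (m - \<alpha>)))" by (simp add: sum_distrib_left)
    also have "\<dots> \<le> K / m * 4" using sum_inverse_sqrt_prod_le \<open>K \<ge> 0\<close> by (intro mult_left_mono) auto
    finally show ?thesis by (simp add: mult.commute)
  qed
  have fin: "finite (SIGMA m:{1..X}. ?M m)" by (rule finite_SigmaI[OF _ fM]) auto
  show "finite (strip_triples X s)"
    by (rule finite_subset[OF strip_triples_subset[OF assms(2)] finite_imageI[OF fin]])
  have "real (card (strip_triples X s)) \<le> real (card (SIGMA m:{1..X}. ?M m))"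
    using surj_card_le[OF fin strip_triples_subset[OF assms(2)]] by simp
  also have "\<dots> = (\<Sum>m=1..X. real (card (?M m)))" using fM by simp
  also have "\<dots> \<le> (\<Sum>m=1..X. 4 * K * (1 / m))" using cM by (intro sum_mono)
  also have "\<dots> = 4 * K * (\<Sum>m=1..X. 1 / m)" by (simp add: sum_distrib_left)
  also have "\<dots> \<le> 4 * K * (1 + ln X)"
    using sum_inverse_le_ln[OF assms(2)] \<open>K \<ge> 0\<close> by (intro mult_left_mono) auto
  also have "\<dots> \<le> 20000 * (real s)\<^sup>2 * real X * sqrt (real s * X) * (1 + ln X)"
  proof (rule mult_right_mono)
    have "sqrt 8 \<le> (3::real)" by (rule real_le_lsqrt) auto
    moreover have "sqrt (8 * real s * X) = sqrt 8 * sqrt (real s * X)" by (simp add: real_sqrt_mult)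
    ultimately have "sqrt (8 * real s * X) \<le> 3 * sqrt (real s * X)" by (simp add: mult_right_mono)
    then have "(6156 * (real s)\<^sup>2 * real X) * sqrt (8 * real s * X) \<le> (6156 * (real s)\<^sup>2 * real X) * (3 * sqrt (real s * X))"
      by (intro mult_left_mono) auto
    also have "\<dots> = 18468 * ((real s)\<^sup>2 * real X * sqrt (real s * X))" by simp
    also have "\<dots> \<le> 20000 * ((real s)\<^sup>2 * real X * sqrt (real s * X))" by (intro mult_right_mono) auto
    finally show "4 * K \<le> 20000 * (real s)\<^sup>2 * real X * sqrt (real s * X)" unfolding K_def by (simp add: mult_ac)
    show "0 \<le> 1 + ln (real X)" using assms(2) by simp
  qed
  finally show "real (card (strip_triples X s)) \<le> 20000 * (real s)\<^sup>2 * real X * sqrt (real s * X) * (1 + ln X)" by simp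
qed

section \<open>Cells along the parabola\<close>

text \<open>For \<open>k > 0\<close> this is the parabola with \<open>X = k * s\<close>, evaluated
  at the left edge \<open>s * i\<close> and rounded down.\<close>

definition cell_height :: "nat \<Rightarrow> nat \<Rightarrow> nat \<Rightarrow> int" where
  "cell_height k s i = int s * int i + (int s * int i * int i) div int k"

definition cell :: "nat \<Rightarrow> nat \<Rightarrow> nat \<Rightarrow> (int \<times> int) set" where
  "cell k s i = {int s * int i..<int s * int i + int s} \<times> {cell_height k s i..<cell_height k s i + int s}"

lemma card_cell: "card (cell k s i) = s\<^sup>2"
  unfolding cell_def by (simp add: card_cartesian_product power2_eq_square)

lemma cell_abscissa_bounds:
  assumes "i < k"
  shows "int s * int i + int s \<le> int (k * s)"
proof -
  have "int s * (int i + 1) \<le> int s * int k" using assms by (intro mult_left_mono) auto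
  then show ?thesis by (simp add: algebra_simps)
qed

lemma cell_subset_box:
  assumes "i < k"
  shows "cell k s i \<subseteq> {0..<int (2 * k * s)} \<times> {0..<int (2 * k * s)}"
proof -
  have "int s * int i * int i \<le> int s * int i * int k" using assms by (intro mult_left_mono) auto
  then have "(int s * int i * int i) div int k \<le> int s * int i"
    using assms zdiv_mono1[of _ _ "int k"] by fastforce
  moreover have "(int s * int i * int i) div int k \<ge> 0" using assms by (simp add: pos_imp_zdiv_nonneg_iff)
  moreover have "0 \<le> int s * int i" by simp
  ultimately have "0 \<le> cell_height k s i" "cell_height k s i \<le> 2 * (int s * int i)" "0 \<le> int s * int i"
    unfolding cell_height_def by linarith+
  then show ?thesis using cell_abscissa_bounds[OF assms, of s] unfolding cell_def by auto
qed

text \<open>Within a cell \<open>y\<close> varies by at most \<open>s\<close>, rounding costs less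
  than 1, and the parabola rises by at most \<open>3 * s\<close>; as \<open>s \<ge> 1\<close>, these
  stay within \<open>4 * s\<close>.\<close>

lemma cell_subset_strip:
  assumes "i < k" "s > 0"
  shows "cell k s i \<subseteq> parabola_strip (k * s) s"
proof
  fix p assume p: "p \<in> cell k s i"
  obtain x y where xy: "p = (x, y)" by (metis surj_pair)
  define e where "e = x - int s * int i"
  have e: "0 \<le> e" "e < int s" and y: "cell_height k s i \<le> y" "y < cell_height k s i + int s"
    using p unfolding xy cell_def e_def by auto
  have "0 \<le> int s * int i" by simp
  then have x: "0 \<le> x" "x < int (k * s)"
    using cell_abscissa_bounds[OF assms(1), of s] e unfolding e_def by linarith+
  have X: "k * s > 0" using assms by simp
  let ?D = "parabola (k * s) x - parabola (k * s) (int s * int i)"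
  have "parabola (k * s) (int s * int i) = real s * i + real s * i * i / k"
    unfolding parabola_def using assms by (simp add: power2_eq_square)
  moreover have "real_of_int ((int s * int i * int i) div int k) = of_int \<lfloor>real s * i * i / k\<rfloor>"
    using floor_divide_of_int_eq[of "int s * int i * int i" "int k", where 'a = real] by simp
  ultimately have h: "of_int (cell_height k s i) \<le> parabola (k * s) (int s * int i)"
    "parabola (k * s) (int s * int i) < of_int (cell_height k s i) + 1"
    using floor_correct[of "real s * i * i / k"] unfolding cell_height_def by simp_all
  have D: "?D = of_int e + (2 * of_int (int s * int i) * of_int e + (of_int e)\<^sup>2) / real (k * s)"
    using parabola_increment[OF X, of "int s * int i" e] unfolding e_def by simp
  have "0 \<le> ?D" unfolding D using e by simp
  moreover have "?D \<le> 3 * of_int e"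
  proof -
    have "real_of_int (2 * (int s * int i) + e) \<le> 2 * real (k * s)"
      using x e unfolding e_def by linarith
    then have "real_of_int (2 * (int s * int i) + e) * of_int e \<le> (2 * real (k * s)) * of_int e"
      using e by (intro mult_right_mono) auto
    then have "(2 * of_int (int s * int i) * of_int e + (of_int e)\<^sup>2) / real (k * s) \<le> 2 * of_int e"
      using X by (simp add: divide_le_eq power2_eq_square algebra_simps)
    then show ?thesis unfolding D by simp
  qed
  moreover have "real_of_int e \<le> real s" using e by linarith
  moreover have "of_int (cell_height k s i) \<le> real_of_int y" "real_of_int y \<le> of_int (cell_height k s i) + real s"
    using y by linarith+
  moreover have "real s \<ge> 1" using assms(2) by simp
  ultimately have "\<bar>of_int y - parabola (k * s) x\<bar> \<le> 4 * real s" using h by linarith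
  then show "p \<in> parabola_strip (k * s) s" unfolding xy parabola_strip_def using x by simp
qed

text \<open>The linear term of \<open>cell_height\<close> grows by \<open>s\<close> per index and
  the quadratic term does not decrease, so each cell ends, in both coordinates, no later than the
  next begins.\<close>

lemma cell_less:
  assumes "i < j" "j < k" "p \<in> cell k s i" "q \<in> cell k s j"
  shows "fst p < fst q" and "snd p \<le> snd q"
proof -
  have le: "int s * int i + int s \<le> int s * int j"
    using cell_abscissa_bounds[OF assms(1), of s] by (simp add: mult.commute)
  have "int s * int i * int i \<le> int s * int j * int j"
    using assms(1) by (intro mult_mono) auto
  then have "(int s * int i * int i) div int k \<le> (int s * int j * int j) div int k"
    using assms by (intro zdiv_mono1) auto
  then show "fst p < fst q" "snd p \<le> snd q"
    using assms(3,4) le unfolding cell_def cell_height_def by auto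
qed

lemma int_collinear_swap:
  "int_collinear q p r \<longleftrightarrow> int_collinear p q r" "int_collinear p r q \<longleftrightarrow> int_collinear p q r"
  unfolding int_collinear_def by (auto simp: algebra_simps)

lemma ex_monotone_int_general_position:
  fixes k s :: nat
  assumes "k > 0" "s > 0" and large: "40000 * sqrt k * (1 + ln (real (k * s))) \<le> (real s)\<^sup>2"
  obtains Q where "Q \<subseteq> {0..<int (2 * k * s)} \<times> {0..<int (2 * k * s)}" "k \<le> 2 * card Q"
    "\<And>p q. p \<in> Q \<Longrightarrow> q \<in> Q \<Longrightarrow> fst p < fst q \<Longrightarrow> snd p \<le> snd q"
    "\<And>p q r. \<lbrakk>p \<in> Q; q \<in> Q; r \<in> Q; p \<noteq> q; p \<noteq> r; q \<noteq> r\<rbrakk> \<Longrightarrow> \<not> int_collinear p q r"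
proof -
  let ?X = "k * s"
  let ?T = "{(i, j, l, p, q, r). i < j \<and> j < l \<and> l < k \<and> p \<in> cell k s i \<and> q \<in> cell k s j \<and>
    r \<in> cell k s l \<and> int_collinear p q r}"
  have X: "?X > 0" using assms by simp
  \<comment> \<open>A point determines its cell, so forgetting the indices of a bad triple is
    injective.\<close>
  have index: "i = nat (fst p div int s)" if "p \<in> cell k s i" for i p
  proof -
    have "int s * int i \<le> fst p" "fst p < int s * int i + int s" using that unfolding cell_def by auto
    then have "fst p div int s = int i" using assms(2)
      by (intro int_div_pos_eq[of _ _ _ "fst p - int s * int i"]) auto
    then show ?thesis by simp
  qed
  have "card ?T \<le> card (strip_triples ?X s)"
  proof (rule card_inj_on_le)
    show "inj_on (\<lambda>(i, j, l, p, q, r). (p, q, r)) ?T"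
      by (rule inj_onI) (use index in \<open>auto, blast+\<close>)
    show "(\<lambda>(i, j, l, p, q, r). (p, q, r)) ` ?T \<subseteq> strip_triples ?X s"
    proof clarify
      fix i j l p q r
      assume *: "i < j" "j < l" "l < k" "p \<in> cell k s i" "q \<in> cell k s j" "r \<in> cell k s l" "int_collinear p q r"
      \<comment> \<open>A whole cell column lies between the outer two, which supplies the gap
        demanded by \<open>strip_triples\<close>.\<close>
      have "int s * (int i + 2) \<le> int s * int l" using * by (intro mult_left_mono) auto
      then have "int s \<le> fst r - fst p" using *(4,6) unfolding cell_def by (auto simp: algebra_simps)
      moreover have "p \<in> parabola_strip ?X s" "q \<in> parabola_strip ?X s" "r \<in> parabola_strip ?X s"
        using * cell_subset_strip[OF _ assms(2)] by (meson order.strict_trans subsetD)+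
      moreover have "fst p < fst q" "fst q < fst r"
        using cell_less(1) * by (meson order.strict_trans)+
      ultimately show "(p, q, r) \<in> strip_triples ?X s" unfolding strip_triples_def using *(7) by simp
    qed
    show "finite (strip_triples ?X s)" by (rule card_strip_triples(1)[OF assms(2) X])
  qed
  then have "real (2 * card ?T) \<le> 2 * real (card (strip_triples ?X s))" by simp
  also have "\<dots> \<le> 2 * (20000 * (real s)\<^sup>2 * real ?X * sqrt (real s * ?X) * (1 + ln ?X))"
    by (rule mult_left_mono[OF card_strip_triples(2)[OF assms(2) X]]) simp
  also have "\<dots> = (real k * real s ^ 4) * (40000 * sqrt k * (1 + ln (real (k * s))))"
  proof -
    have "sqrt (real s * ?X) = real s * sqrt k"
      by (simp add: real_sqrt_mult)
    then show ?thesis by (simp add: power2_eq_square power4_eq_xxxx)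
  qed
  \<comment> \<open>This is where \<open>large\<close> enters: it is the requirement of
    \<open>transversal_avoiding_triples\<close> for cells with \<open>S = s\<^sup>2\<close>
    points.\<close>
  also have "\<dots> \<le> (real k * real s ^ 4) * (real s)\<^sup>2" using large by (intro mult_left_mono) auto
  also have "\<dots> = real (k * (s\<^sup>2) ^ 3)" by (simp flip: power_mult power_add)
  finally have "2 * card ?T \<le> k * (s\<^sup>2) ^ 3" by linarith
  from transversal_avoiding_triples[OF card_cell _ this] assms(2)
  obtain f J where J: "J \<subseteq> {..<k}" "k \<le> 2 * card J" "\<And>i. i \<in> J \<Longrightarrow> f i \<in> cell k s i"
    and nc: "\<And>i j l. \<lbrakk>i \<in> J; j \<in> J; l \<in> J; i < j; j < l\<rbrakk> \<Longrightarrow> \<not> int_collinear (f i) (f j) (f l)"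
    by (metis zero_less_power)
  have Jk: "j < k" if "j \<in> J" for j using J(1) that by auto
  have less: "fst (f i) < fst (f j)" "snd (f i) \<le> snd (f j)" if "i \<in> J" "j \<in> J" "i < j" for i j
    using cell_less[OF that(3) Jk[OF that(2)] J(3)[OF that(1)] J(3)[OF that(2)]] .
  show ?thesis
  proof (rule that[of "f ` J"])
    show "f ` J \<subseteq> {0..<int (2 * k * s)} \<times> {0..<int (2 * k * s)}"
      using J(3) Jk cell_subset_box by blast
    have "inj_on f J" by (rule linorder_inj_onI') (use less(1) in fastforce)
    then show "k \<le> 2 * card (f ` J)" using J(2) by (simp add: card_image)
  next
    fix p q assume "p \<in> f ` J" "q \<in> f ` J" "fst p < fst q"
    then show "snd p \<le> snd q" using less by (metis (full_types) imageE linorder_less_linear order_less_asym)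
  next
    fix p q r assume "p \<in> f ` J" "q \<in> f ` J" "r \<in> f ` J" and ne: "p \<noteq> q" "p \<noteq> r" "q \<noteq> r"
    then obtain i j l where ijl: "i \<in> J" "j \<in> J" "l \<in> J" "p = f i" "q = f j" "r = f l" by blast
    then have "i \<noteq> j" "i \<noteq> l" "j \<noteq> l" using ne by auto
    then consider "i < j" "j < l" | "i < l" "l < j" | "j < i" "i < l" | "j < l" "l < i" | "l < i" "i < j" | "l < j" "j < i"
      by linarith
    then show "\<not> int_collinear p q r"
      unfolding ijl(4-6) using nc ijl(1-3) by cases (metis int_collinear_swap)+
  qed
qed

section \<open>Passing to the maximum over a grid and to asymptotics\<close>

lemma finite_square_integer_grid: "square_integer_grid k G \<Longrightarrow> finite G"
  unfolding square_integer_grid_def by auto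

lemma max_monotone_gp_ge:
  assumes "finite G" "P \<subseteq> G" "monotone_points P" "general_position P"
  shows "card P \<le> max_monotone_gp G"
proof -
  have "{card P | P. P \<subseteq> G \<and> monotone_points P \<and> general_position P} \<subseteq> card ` Pow G" by blast
  then have "finite {card P | P. P \<subseteq> G \<and> monotone_points P \<and> general_position P}"
    by (rule finite_subset) (simp add: assms(1))
  then show ?thesis unfolding max_monotone_gp_def using assms by (intro Max_ge) auto
qed

lemma max_monotone_gp_attained:
  assumes "finite G"
  obtains P where "P \<subseteq> G" "monotone_points P" "general_position P" "card P = max_monotone_gp G"
proof -
  let ?S = "{card P | P. P \<subseteq> G \<and> monotone_points P \<and> general_position P}"
  have "?S \<subseteq> card ` Pow G" by blast
  then have "finite ?S" by (rule finite_subset) (simp add: assms(1))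
  moreover have "card ({} :: (real \<times> real) set) \<in> ?S"
    unfolding monotone_points_def general_position_def by blast
  ultimately have "Max ?S \<in> ?S" by (intro Max_in) auto
  then show ?thesis using that unfolding max_monotone_gp_def by auto
qed

lemma max_monotone_gp_ge_half:
  assumes G: "square_integer_grid N G" and "k > 0" "s > 0" "2 * k * s \<le> N"
    and "40000 * sqrt k * (1 + ln (real (k * s))) \<le> (real s)\<^sup>2"
  shows "k \<le> 2 * max_monotone_gp G"
proof -
  obtain a b where Geq: "G = real_of_int ` {a..<a + int N} \<times> real_of_int ` {b..<b + int N}"
    using G unfolding square_integer_grid_def by blast
  obtain Q where Q: "Q \<subseteq> {0..<int (2 * k * s)} \<times> {0..<int (2 * k * s)}" "k \<le> 2 * card Q"
    "\<And>p q. p \<in> Q \<Longrightarrow> q \<in> Q \<Longrightarrow> fst p < fst q \<Longrightarrow> snd p \<le> snd q"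
    "\<And>p q r. \<lbrakk>p \<in> Q; q \<in> Q; r \<in> Q; p \<noteq> q; p \<noteq> r; q \<noteq> r\<rbrakk> \<Longrightarrow> \<not> int_collinear p q r"
    using ex_monotone_int_general_position[OF assms(2,3,5)] by blast
  define g where "g p = (real_of_int (a + fst p), real_of_int (b + snd p))" for p :: "int \<times> int"
  have "inj g" unfolding g_def by (auto intro: injI simp: prod_eq_iff)
  have "g ` Q \<subseteq> G"
  proof (rule image_subsetI)
    fix p assume "p \<in> Q"
    then have "fst p \<in> {0..<int (2 * k * s)}" "snd p \<in> {0..<int (2 * k * s)}" using Q(1) by auto
    moreover have "int (2 * k * s) \<le> int N" using assms(4) by (rule zle_int[THEN iffD2])
    ultimately have "a + fst p \<in> {a..<a + int N}" "b + snd p \<in> {b..<b + int N}" by auto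
    then show "g p \<in> G" unfolding g_def Geq by blast
  qed
  moreover have "monotone_points (g ` Q)"
    unfolding monotone_points_def g_def using Q(3) by simp
  moreover have "general_position (g ` Q)"
    unfolding general_position_def
  proof (intro ballI impI)
    fix u v w assume "u \<in> g ` Q" "v \<in> g ` Q" "w \<in> g ` Q" and ne: "u \<noteq> v \<and> u \<noteq> w \<and> v \<noteq> w"
    then obtain p q r where pqr: "p \<in> Q" "q \<in> Q" "r \<in> Q" "u = g p" "v = g q" "w = g r" by blast
    then have "\<not> int_collinear p q r" using Q(4) ne by blast
    then have "real_of_int ((fst q - fst p) * (snd r - snd p)) \<noteq> real_of_int ((fst r - fst p) * (snd q - snd p))"
      unfolding int_collinear_def of_int_eq_iff .
    then show "\<not> collinear {u, v, w}"
      unfolding collinear_iff_det pqr(4-6) g_def by simp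
  qed
  ultimately have "card (g ` Q) \<le> max_monotone_gp G"
    using max_monotone_gp_ge finite_square_integer_grid[OF G] by blast
  moreover have "card (g ` Q) = card Q" using \<open>inj g\<close> by (meson card_image inj_on_subset subset_UNIV)
  ultimately show ?thesis using Q(2) by linarith
qed

lemma powr_five_halves:
  fixes x :: real
  assumes "x > 0" shows "x powr (5 / 2) = x\<^sup>2 * sqrt x"
proof -
  have "x powr (5 / 2) = x powr (2 + 1 / 2)" by simp
  also have "\<dots> = x powr 2 * x powr (1 / 2)" by (rule powr_add)
  finally show ?thesis using assms by (simp add: powr_half_sqrt)
qed

text \<open>Cells of side about \<open>z N\<close> are the smallest, up to constants, that the
  triple count is shown to allow; about \<open>N / (2 * s)\<close> of them fit, and half of that
  number is guaranteed.\<close>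

lemma max_monotone_gp_lower:
  "\<exists>M. \<forall>N\<ge>M. \<forall>G. square_integer_grid N G \<longrightarrow>
     (real (N\<^sup>2) / ln (real (N\<^sup>2))) powr (2 / 5) \<le> 640000 * real (max_monotone_gp G)"
proof -
  \<comment> \<open>Multiplying \<open>large\<close> by \<open>sqrt s\<close> and using
    \<open>k * s \<le> N\<close> and \<open>1 + ln (k * s) \<le> 2 * ln N\<close> turns it into
    \<open>s powr (5 / 2) \<ge> 80000 * sqrt N * ln N\<close>; \<open>z N\<close> solves this with
    equality.\<close>
  define z where "z N = (80000 * sqrt (real N) * ln (real N)) powr (2 / 5)" for N :: nat
  have "eventually (\<lambda>N::nat. 8 * z N \<le> N) at_top" unfolding z_def by real_asymp
  moreover have "eventually (\<lambda>N::nat. z N \<ge> 1) at_top" unfolding z_def by real_asymp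
  moreover have "eventually (\<lambda>N::nat. ln (real N) \<ge> 1) at_top" by real_asymp
  moreover have "eventually (\<lambda>N::nat. N \<ge> 1) at_top" by (rule eventually_ge_at_top)
  ultimately have "eventually (\<lambda>N. 8 * z N \<le> N \<and> z N \<ge> 1 \<and> ln (real N) \<ge> 1 \<and> N \<ge> 1) at_top"
    by eventually_elim simp
  then obtain M where M: "\<And>N. N \<ge> M \<Longrightarrow> 8 * z N \<le> N \<and> z N \<ge> 1 \<and> ln (real N) \<ge> 1 \<and> N \<ge> 1"
    unfolding eventually_at_top_linorder by blast
  show ?thesis
  proof (intro exI allI impI)
    fix N G assume "N \<ge> M" and G: "square_integer_grid N G"
    then have N: "8 * z N \<le> N" "z N \<ge> 1" "ln (real N) \<ge> 1" "N \<ge> 1" using M by auto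
    define s where "s = nat \<lceil>z N\<rceil>"
    define k where "k = N div (2 * s)"
    have s: "z N \<le> real s" "real s \<le> 2 * z N" "s > 0" unfolding s_def using N(2) by linarith+
    have ks: "2 * k * s \<le> N" unfolding k_def
      by (metis div_times_less_eq_dividend mult.assoc mult.commute)
    have "real N < (real k + 1) * (2 * real s)"
    proof -
      have "N < (k + 1) * (2 * s)" unfolding k_def using s(3) dividend_less_div_times[of "2 * s" N] by simp
      then have "real N < real ((k + 1) * (2 * s))" by (rule of_nat_less_iff[THEN iffD2])
      then show ?thesis by (simp add: algebra_simps)
    qed
    \<comment> \<open>The rounding in \<open>k\<close> costs less than
      \<open>2 * s \<le> N / 2\<close>, so \<open>2 * k * s\<close> is still at least half of
      \<open>N\<close>.\<close>
    moreover have "4 * real s \<le> N" using s(2) N(1) by linarith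
    ultimately have kN: "real N \<le> 4 * (real k * real s)" by (simp add: algebra_simps)
    have "k > 0" using kN N(4) by (cases k) auto
    have "40000 * sqrt k * (1 + ln (real (k * s))) \<le> (real s)\<^sup>2"
    proof -
      have "real (k * s) \<le> real N" using ks by linarith
      have X1: "k * s \<ge> 1" using \<open>k > 0\<close> s(3) by (simp add: Suc_le_eq)
      have "ln (real (k * s)) \<le> ln (real N)" using \<open>real (k * s) \<le> real N\<close> X1 by (intro ln_mono) linarith+
      then have 1: "1 + ln (real (k * s)) \<le> 2 * ln (real N)" using N(3) by linarith
      have 2: "sqrt k * sqrt s \<le> sqrt N" using \<open>real (k * s) \<le> real N\<close> by (simp flip: real_sqrt_mult)
      have "ln (real (k * s)) \<ge> 0" using X1 by (intro ln_ge_zero) linarith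
      then have "(sqrt k * sqrt s) * (1 + ln (real (k * s))) \<le> sqrt N * (2 * ln (real N))"
        using 1 2 by (intro mult_mono) auto
      then have "40000 * sqrt k * (1 + ln (real (k * s))) * sqrt s \<le> 80000 * sqrt N * ln (real N)"
        by (simp add: algebra_simps)
      also have "\<dots> = z N powr (5 / 2)" unfolding z_def using N(3) by (simp add: powr_powr)
      also have "\<dots> \<le> real s powr (5 / 2)" using s(1) N(2) by (intro powr_mono2) auto
      also have "\<dots> = (real s)\<^sup>2 * sqrt s" using s(3) by (simp add: powr_five_halves)
      finally show ?thesis using s(3) by simp
    qed
    from max_monotone_gp_ge_half[OF G \<open>k > 0\<close> s(3) ks this]
    have "real k \<le> 2 * real (max_monotone_gp G)" by linarith
    then have "real k * real s \<le> 2 * real (max_monotone_gp G) * (2 * z N)"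
      using s by (intro mult_mono) auto
    then have Nle: "real N \<le> 16 * real (max_monotone_gp G) * z N" using kN by linarith
    define B where "B = (real (N\<^sup>2) / ln (real (N\<^sup>2))) powr (2 / 5)"
    \<comment> \<open>Multiplying by \<open>z N\<close> cancels the logarithms: the bases multiply
      to \<open>40000 * N powr (5 / 2)\<close>. With the factor 16 in \<open>Nle\<close> this gives
      640000.\<close>
    have "B * z N = (40000 * (real N powr (5 / 2))) powr (2 / 5)"
    proof -
      have "real N powr (5 / 2) = (real N)\<^sup>2 * sqrt N" using N(4) by (simp add: powr_five_halves)
      moreover have "ln (real (N\<^sup>2)) = 2 * ln (real N)" using N(4) by (simp add: ln_realpow)
      moreover have "B * z N = (real (N\<^sup>2) / ln (real (N\<^sup>2)) * (80000 * sqrt (real N) * ln (real N))) powr (2 / 5)"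
        unfolding B_def z_def using N(3,4) calculation(2) by (subst powr_mult) auto
      ultimately show ?thesis using N(3) by (simp add: field_simps)
    qed
    also have "\<dots> = 40000 powr (2 / 5) * real N" using N(4) by (simp add: powr_mult powr_powr)
    also have "\<dots> \<le> 40000 * real N"
      using powr_mono[of "2 / 5" 1 "40000 :: real"] by (intro mult_right_mono) auto
    also have "\<dots> \<le> 640000 * real (max_monotone_gp G) * z N" using Nle by linarith
    finally show "B \<le> 640000 * real (max_monotone_gp G)" using N(2) by simp
  qed
qed

lemma max_monotone_gp_upper:
  fixes c :: real
  assumes "c > 0"
  shows "\<exists>M. \<forall>N\<ge>M. \<forall>G. square_integer_grid N G \<longrightarrow> real (max_monotone_gp G) \<le> c * real N"
  using monotone_gp_card_upper[OF assms] max_monotone_gp_attained finite_square_integer_grid by metis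

lemma eventually_at_top_squaresI:
  assumes "\<And>k. k \<ge> M \<Longrightarrow> P (k\<^sup>2)"
  shows "eventually P at_top_squares"
  unfolding at_top_squares_def eventually_inf_principal
proof (rule eventually_mono[OF eventually_ge_at_top[of "M\<^sup>2"]], clarify)
  fix n assume "M\<^sup>2 \<le> n" "is_square n"
  then obtain k where "n = k\<^sup>2" by (auto simp: is_nth_power_def)
  moreover from this have "k \<ge> M" using \<open>M\<^sup>2 \<le> n\<close> power2_nat_le_eq_le by simp
  ultimately show "P n" using assms by simp
qed

theorem theorem1p5:
  fixes G :: "nat \<Rightarrow> (real \<times> real) set"
  assumes "\<And>n k. n = k\<^sup>2 \<Longrightarrow> square_integer_grid k (G n)"
  shows "(\<lambda>n. real (max_monotone_gp (G n)))
           \<in> \<Omega>[at_top_squares](\<lambda>n. (real n / ln (real n)) powr (2 / 5)) \<and>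
         (\<lambda>n. real (max_monotone_gp (G n)))
           \<in> o[at_top_squares](\<lambda>n. real n powr (1 / 2))"
proof
  have grid: "square_integer_grid k (G (k\<^sup>2))" for k using assms by blast
  show "(\<lambda>n. real (max_monotone_gp (G n)))
          \<in> \<Omega>[at_top_squares](\<lambda>n. (real n / ln (real n)) powr (2 / 5))"
  proof (rule landau_omega.bigI[of "1 / 640000"])
    obtain M where M: "\<And>N. N \<ge> M \<Longrightarrow>
        (real (N\<^sup>2) / ln (real (N\<^sup>2))) powr (2 / 5) \<le> 640000 * real (max_monotone_gp (G (N\<^sup>2)))"
      using max_monotone_gp_lower grid by metis
    show "\<forall>\<^sub>F n in at_top_squares. 1 / 640000 * norm ((real n / ln (real n)) powr (2 / 5))
        \<le> norm (real (max_monotone_gp (G n)))"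
      by (rule eventually_at_top_squaresI[of M]) (use M in force)
  qed simp
  show "(\<lambda>n. real (max_monotone_gp (G n))) \<in> o[at_top_squares](\<lambda>n. real n powr (1 / 2))"
  proof (rule landau_o.smallI)
    fix c :: real assume "c > 0"
    then obtain M where M: "\<And>N. N \<ge> M \<Longrightarrow> real (max_monotone_gp (G (N\<^sup>2))) \<le> c * real N"
      using max_monotone_gp_upper grid by metis
    show "\<forall>\<^sub>F n in at_top_squares. norm (real (max_monotone_gp (G n))) \<le> c * norm (real n powr (1 / 2))"
      by (rule eventually_at_top_squaresI[of M]) (use M in \<open>simp add: powr_half_sqrt\<close>)
  qed
qed

end
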